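(* Let $0<r\le n$, $R=\{1,\ldots,r\}$, $N=\{1,\ldots,n\}$. Suppose given an injective map $w:R\to N$, $(\tau_1,\ldots,\tau_r)\in\{0,1\}^r$, $(m_1,\ldots,m_r)\in(\mathbb{Z}\setminus\{0\})^r$, $(b_1,\ldots,b_r),(\gamma_1,\ldots,\gamma_r)\in(\Bbbk^* )^r$, a matrix $(t_{i,j})\in\mathcal{M}_{r,n}(\mathbb{Z})$ and Laurent polynomials $p_i,p_i'$ in one variable ($i\in R$) such that for all $i,l\in R$: $q_{w(i)}^{(-1)^{\tau_i}m_i}=\widetilde q_i$; $q_{w(i)}^{t_{l,w(i)}(1-\tau_i)}q_{w(i)}^{-t_{l,w(i)}\tau_i}q_{w(l)}^{-t_{i,w(l)}(1-\tau_l)}q_{w(l)}^{t_{i,w(l)}\tau_l}=1$; $p_i(h_{w(i)})p_i'(h_{w(i)})a_d(q_{w(i)}^{1-\tau_i}h_{w(i)})=a_d(\widetilde q_i\gamma_ih_{w(i)}^{m_i})$; and $\gamma_i^d=\widetilde q_i^{-\tau_id}$. Then there is a unique $\Bbbk$-algebra homomorphism $\psi:\widetilde A(r,d,\underline{\widetilde q})\to A(n,d,\underline q)$ with $\psi(\widetilde h_i)=\gamma_ih_{w(i)}^{m_i}$, $\psi(\widetilde x_i)=p_i(h_{w(i)})\,b_i\,h_1^{t_{i,1}}\cdots h_n^{t_{i,n}}\,x_{w(i)}^{1-\tau_i}y_{w(i)}^{\tau_i}$, $\psi(\widetilde y_i)=x_{w(i)}^{\tau_i}y_{w(i)}^{1-\tau_i}\,p_i'(h_{w(i)})\,b_i^{-1}\,h_1^{-t_{i,1}}\cdots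 h_n^{-t_{i,n}}$ for all $i\in R$.
   Context: Let $\Bbbk$ be a field, $d\ge1$, and write $a_d(X)=X^d-1$. For a positive integer $n$ and $\underline{q}=(q_1,\ldots,q_n)\in(\Bbbk^* )^n$ with $q_i^d\neq1$ for all $i$, $A(n,d,\underline{q})$ is the $\Bbbk$-algebra generated by $x_i,y_i,h_i,h_i^{-1}$ ($1\le i\le n$) subject to $h_ih_i^{-1}=h_i^{-1}h_i=1$, $x_ih_i=q_ih_ix_i$, $y_ih_i=q_i^{-1}h_iy_i$, $x_iy_i=(q_ih_i)^d-1$, $y_ix_i=h_i^d-1$, and, for $i\neq j$, each of $h_i^{\pm1},x_i,y_i$ commutes with each of $h_j^{\pm1},x_j,y_j$. For $\underline{\widetilde q}=(\widetilde q_1,\ldots,\widetilde q_r)\in(\Bbbk^* )^r$ with $\widetilde q_i^d\ne1$, $\widetilde A(r,d,\underline{\widetilde q})$ denotes the algebra $A(r,d,\underline{\widetilde q})$ with its generators written $\widetilde x_i,\widetilde y_i,\widetilde h_i^{\pm1}$. Exponents such as $x^{1-\tau_i}y^{\tau_i}$ with $\tau_i\in\{0,1\}$ mean $x$ if $\tau_i=0$ and $y$ if $\tau_i=1$. *)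

theory Defs
  imports "HOL-Algebra.Algebra" "HOL-Library.Poly_Mapping"
begin

text \<open>Elements of the free algebra k<G> are finitely supported functions from words
  (lists of generators from G) to k; product is concatenation convolution.\<close>

definition galg :: "'g set \<Rightarrow> ('g list \<Rightarrow> 'k::field) ring" where
  "galg G = \<lparr>carrier = {f. finite {w. f w \<noteq> 0} \<and> (\<forall>w. f w \<noteq> 0 \<longrightarrow> set w \<subseteq> G)},
     monoid.mult = (\<lambda>f g w. \<Sum>i\<le>length w. f (take i w) * g (drop i w)),
     monoid.one = (\<lambda>w. if w = [] then 1 else 0),
     ring.zero = (\<lambda>w. 0),
     ring.add = (\<lambda>f g w. f w + g w)\<rparr>"

definition fgen :: "'g \<Rightarrow> ('g list \<Rightarrow> 'k::field)" where
  "fgen g = (\<lambda>w. if w = [g] then 1 else 0)"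

definition fsc :: "'k::field \<Rightarrow> ('g list \<Rightarrow> 'k)" where
  "fsc c = (\<lambda>w. if w = [] then c else 0)"

definition pres :: "'g set \<Rightarrow> ('g list \<Rightarrow> 'k::field) set \<Rightarrow> ('g list \<Rightarrow> 'k) set ring" where
  "pres G Rel = galg G Quot (genideal (galg G) Rel)"

definition pcls :: "'g set \<Rightarrow> ('g list \<Rightarrow> 'k::field) set \<Rightarrow> ('g list \<Rightarrow> 'k) \<Rightarrow> ('g list \<Rightarrow> 'k) set" where
  "pcls G Rel f = a_r_coset (galg G) (genideal (galg G) Rel) f"

datatype gen = Gx nat | Gy nat | Gh nat | Ghi nat   \<comment> \<open>x_i, y_i, h_i, h_i^{-1}\<close>

fun gidx :: "gen \<Rightarrow> nat" where
  "gidx (Gx i) = i" | "gidx (Gy i) = i" | "gidx (Gh i) = i" | "gidx (Ghi i) = i"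

definition Agens :: "nat \<Rightarrow> gen set" where
  "Agens n = {g. gidx g \<in> {1..n}}"

definition Arels :: "nat \<Rightarrow> nat \<Rightarrow> (nat \<Rightarrow> 'k::field) \<Rightarrow> (gen list \<Rightarrow> 'k) set" where
  "Arels n d q =
    (\<Union>i\<in>{1..n}.
      { fgen (Gh i) \<otimes>\<^bsub>galg (Agens n)\<^esub> fgen (Ghi i) \<ominus>\<^bsub>galg (Agens n)\<^esub> \<one>\<^bsub>galg (Agens n)\<^esub>,
        fgen (Ghi i) \<otimes>\<^bsub>galg (Agens n)\<^esub> fgen (Gh i) \<ominus>\<^bsub>galg (Agens n)\<^esub> \<one>\<^bsub>galg (Agens n)\<^esub>,
        fgen (Gx i) \<otimes>\<^bsub>galg (Agens n)\<^esub> fgen (Gh i) \<ominus>\<^bsub>galg (Agens n)\<^esub>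
          fsc (q i) \<otimes>\<^bsub>galg (Agens n)\<^esub> fgen (Gh i) \<otimes>\<^bsub>galg (Agens n)\<^esub> fgen (Gx i),
        fgen (Gy i) \<otimes>\<^bsub>galg (Agens n)\<^esub> fgen (Gh i) \<ominus>\<^bsub>galg (Agens n)\<^esub>
          fsc (inverse (q i)) \<otimes>\<^bsub>galg (Agens n)\<^esub> fgen (Gh i) \<otimes>\<^bsub>galg (Agens n)\<^esub> fgen (Gy i),
        fgen (Gx i) \<otimes>\<^bsub>galg (Agens n)\<^esub> fgen (Gy i) \<ominus>\<^bsub>galg (Agens n)\<^esub>
          ((fsc (q i) \<otimes>\<^bsub>galg (Agens n)\<^esub> fgen (Gh i)) [^]\<^bsub>galg (Agens n)\<^esub> d
            \<ominus>\<^bsub>galg (Agens n)\<^esub> \<one>\<^bsub>galg (Agens n)\<^esub>),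
        fgen (Gy i) \<otimes>\<^bsub>galg (Agens n)\<^esub> fgen (Gx i) \<ominus>\<^bsub>galg (Agens n)\<^esub>
          (fgen (Gh i) [^]\<^bsub>galg (Agens n)\<^esub> d \<ominus>\<^bsub>galg (Agens n)\<^esub> \<one>\<^bsub>galg (Agens n)\<^esub>) })
    \<union> {fgen a \<otimes>\<^bsub>galg (Agens n)\<^esub> fgen b \<ominus>\<^bsub>galg (Agens n)\<^esub> fgen b \<otimes>\<^bsub>galg (Agens n)\<^esub> fgen a
        | a b. a \<in> Agens n \<and> b \<in> Agens n \<and> gidx a \<noteq> gidx b}"

text \<open>A(n,d,q) as a ring; its k-structure is given by the scalars sA.\<close>

definition AA :: "nat \<Rightarrow> nat \<Rightarrow> (nat \<Rightarrow> 'k::field) \<Rightarrow> (gen list \<Rightarrow> 'k) set ring" where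
  "AA n d q = pres (Agens n) (Arels n d q)"

definition clA :: "nat \<Rightarrow> nat \<Rightarrow> (nat \<Rightarrow> 'k::field) \<Rightarrow> (gen list \<Rightarrow> 'k) \<Rightarrow> (gen list \<Rightarrow> 'k) set" where
  "clA n d q f = pcls (Agens n) (Arels n d q) f"

definition sA :: "nat \<Rightarrow> nat \<Rightarrow> (nat \<Rightarrow> 'k::field) \<Rightarrow> 'k \<Rightarrow> (gen list \<Rightarrow> 'k) set" where
  "sA n d q c = clA n d q (fsc c)"

definition xA :: "nat \<Rightarrow> nat \<Rightarrow> (nat \<Rightarrow> 'k::field) \<Rightarrow> nat \<Rightarrow> (gen list \<Rightarrow> 'k) set" where
  "xA n d q i = clA n d q (fgen (Gx i))"

definition yA :: "nat \<Rightarrow> nat \<Rightarrow> (nat \<Rightarrow> 'k::field) \<Rightarrow> nat \<Rightarrow> (gen list \<Rightarrow> 'k) set" where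
  "yA n d q i = clA n d q (fgen (Gy i))"

definition hA :: "nat \<Rightarrow> nat \<Rightarrow> (nat \<Rightarrow> 'k::field) \<Rightarrow> nat \<Rightarrow> (gen list \<Rightarrow> 'k) set" where
  "hA n d q i = clA n d q (fgen (Gh i))"

definition hiA :: "nat \<Rightarrow> nat \<Rightarrow> (nat \<Rightarrow> 'k::field) \<Rightarrow> nat \<Rightarrow> (gen list \<Rightarrow> 'k) set" where
  "hiA n d q i = clA n d q (fgen (Ghi i))"

definition hpow :: "nat \<Rightarrow> nat \<Rightarrow> (nat \<Rightarrow> 'k::field) \<Rightarrow> nat \<Rightarrow> int \<Rightarrow> (gen list \<Rightarrow> 'k) set" where
  "hpow n d q i e = (if 0 \<le> e then hA n d q i [^]\<^bsub>AA n d q\<^esub> nat e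
                     else hiA n d q i [^]\<^bsub>AA n d q\<^esub> nat (- e))"

text \<open>Evaluation p(h_i) of a one-variable Laurent polynomial p = sum_j c_j X^j
  (represented as a finitely supported map int =>0 k, j |-> c_j).\<close>
definition lev :: "nat \<Rightarrow> nat \<Rightarrow> (nat \<Rightarrow> 'k::field) \<Rightarrow> (int \<Rightarrow>\<^sub>0 'k) \<Rightarrow> nat \<Rightarrow> (gen list \<Rightarrow> 'k) set" where
  "lev n d q p i = finsum (AA n d q) (\<lambda>j. sA n d q (Poly_Mapping.lookup p j) \<otimes>\<^bsub>AA n d q\<^esub> hpow n d q i j) (Poly_Mapping.keys p)"

definition hmono :: "nat \<Rightarrow> nat \<Rightarrow> (nat \<Rightarrow> 'k::field) \<Rightarrow> (nat \<Rightarrow> int) \<Rightarrow> (gen list \<Rightarrow> 'k) set" where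
  "hmono n d q e = foldr (\<lambda>j acc. hpow n d q j (e j) \<otimes>\<^bsub>AA n d q\<^esub> acc) [1..<n+1] \<one>\<^bsub>AA n d q\<^esub>"

definition kalg_hom :: "'a ring \<Rightarrow> ('k \<Rightarrow> 'a) \<Rightarrow> 'b ring \<Rightarrow> ('k \<Rightarrow> 'b) \<Rightarrow> ('a \<Rightarrow> 'b) \<Rightarrow> bool" where
  "kalg_hom R sR S sS \<psi> \<longleftrightarrow> \<psi> \<in> ring_hom R S \<and> (\<forall>c. \<psi> (sR c) = sS c)"

end

theory Submission
  imports Defs
begin

text \<open>
  A homomorphism out of a presented algebra is the same thing as a choice of images of the generators
  satisfying the relations, so everything reduces to checking these relations for the proposed images.
  The commutation relations are bookkeeping with scalars \<open>c\<close> such that \<open>a b = c b a\<close>; the condition on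
  the matrix \<open>t\<close> says exactly that these scalars are 1 between different indices. The relation for
  \<open>\<psi>(x) \<psi>(y)\<close> is the hypothesis on \<open>p, p'\<close>; the one for \<open>\<psi>(y) \<psi>(x)\<close> is the same identity after
  rescaling the variable \<open>h\<close> by \<open>q\<close>. To rescale one has to know that an identity between Laurent
  polynomials in \<open>h\<close> that holds in the algebra holds between the polynomials themselves; this follows
  from an action of the algebra on functions on an integer lattice, in which \<open>h\<close> acts by a shift.
\<close>

text \<open>The rescaling of \<open>h\<close> has to happen on polynomials because it cannot be done
  inside the algebra. Moving \<open>x\<close> or \<open>y\<close> past an identity in
  \<open>h\<close> does rescale it, but the result is still multiplied by that generator, and the
  relations give no inverse by which to cancel it. In the action on lattice functions
  \<open>x\<close> does act invertibly, which is why \<open>y\<close> can be defined there as (h^d -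
  1) x^-1. Two choices keep the casework small. The relations are a property of a family of elements
  in an arbitrary ring with central scalars, so the same calculus serves the algebra itself, the
  lattice operators and the proposed images. And the images of \<open>x\<close> and of
  \<open>y\<close> are brought to one common shape with the generator at the right end, so that a
  single commutation lemma covers all pairs and both values of \<tau>.\<close>

locale central_algebra = ring R for R :: "'a ring" (structure) +
  fixes s :: "'k::field \<Rightarrow> 'a"
  assumes s_closed [simp]: "s c \<in> carrier R"
    and s_add: "s (c + c') = s c \<oplus> s c'"
    and s_mult: "s (c * c') = s c \<otimes> s c'"
    and s_one [simp]: "s 1 = \<one>"
    and s_central: "a \<in> carrier R \<Longrightarrow> s c \<otimes> a = a \<otimes> s c"
begin

lemma s_zero [simp]: "s 0 = \<zero>"
  by (metis add.l_cancel_one' add.left_neutral s_add s_closed)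

lemma s_central_assoc:
  assumes "a \<in> carrier R" "b \<in> carrier R"
  shows "a \<otimes> (s c \<otimes> b) = s c \<otimes> (a \<otimes> b)"
  using assms by (metis m_assoc s_central s_closed)

lemma s_mult_mult:
  assumes "a \<in> carrier R" "b \<in> carrier R"
  shows "(s c \<otimes> a) \<otimes> (s c' \<otimes> b) = s (c * c') \<otimes> (a \<otimes> b)"
  using assms by (simp add: s_mult m_assoc s_central_assoc[of a b])

lemma s_inverse [simp]:
  "c \<noteq> 0 \<Longrightarrow> s c \<otimes> s (inverse c) = \<one>" "c \<noteq> 0 \<Longrightarrow> s (inverse c) \<otimes> s c = \<one>"
  by (simp_all flip: s_mult)

end

section \<open>The free algebra and its quotients\<close>

definition conv :: "('g list \<Rightarrow> 'k::field) \<Rightarrow> ('g list \<Rightarrow> 'k) \<Rightarrow> 'g list \<Rightarrow> 'k" where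
  "conv f g w = (\<Sum>i\<le>length w. f (take i w) * g (drop i w))"

lemma conv_Nil [simp]: "conv f g [] = f [] * g []"
  by (simp add: conv_def)

text \<open>Splits off the empty prefix. What remains is again a convolution, with \<open>f\<close>
  replaced by its left quotient by \<open>x\<close>; identities of convolutions thus follow by
  induction on the word, without reindexing double sums.\<close>

lemma conv_Cons [simp]: "conv f g (x # w) = f [] * g (x # w) + conv (\<lambda>u. f (x # u)) g w"
  by (simp add: conv_def sum.atMost_Suc_shift del: sum.atMost_Suc)

lemma conv_add_left: "conv (\<lambda>u. f u + g u) h w = conv f h w + conv g h w"
  by (simp add: conv_def sum.distrib algebra_simps)

lemma conv_add_right: "conv f (\<lambda>u. g u + h u) w = conv f g w + conv f h w"
  by (simp add: conv_def sum.distrib algebra_simps)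

lemma conv_scale_left: "conv (\<lambda>u. c * f u) g w = c * conv f g w"
  by (simp add: conv_def sum_distrib_left mult.assoc)

lemma conv_zero_left [simp]: "conv (\<lambda>u. 0) g w = 0"
  by (simp add: conv_def)

lemma conv_assoc: "conv (conv f g) h w = conv f (conv g h) w"
\<comment> \<open>\<open>f\<close> is generalised because the step passes to its left
  quotient.\<close>
proof (induction w arbitrary: f)
  case (Cons x w)
  have "conv (\<lambda>u. conv f g (x # u)) h w
      = conv (\<lambda>u. f [] * g (x # u)) h w + conv (conv (\<lambda>u. f (x # u)) g) h w"
    by (simp add: conv_add_left)
  then show ?case
    using Cons.IH by (simp add: conv_scale_left algebra_simps)
qed simp

text \<open>Scalars and generators are both of this form, so one product formula,
  \<open>conv_wmon_wmon\<close>, covers them all.\<close>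

definition wmon :: "'k::field \<Rightarrow> 'g list \<Rightarrow> 'g list \<Rightarrow> 'k" where
  "wmon c u = (\<lambda>w. if w = u then c else 0)"

lemma fsc_eq_wmon: "fsc c = wmon c []"
  by (simp add: fsc_def wmon_def)

lemma fgen_eq_wmon: "fgen g = wmon 1 [g]"
  by (simp add: fgen_def wmon_def)

lemma conv_wmon_Nil: "conv (wmon c []) g w = c * g w"
  by (cases w) (simp_all add: wmon_def)

lemma conv_Nil_wmon: "conv f (wmon c []) w = f w * c"
  by (induction w arbitrary: f) (simp_all add: wmon_def)

lemma conv_wmon_wmon: "conv (wmon c u) (wmon c' v) w = wmon (c * c') (u @ v) w"
proof (induction u arbitrary: w)
  case Nil
  then show ?case by (simp add: conv_wmon_Nil) (simp add: wmon_def)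
next
  case (Cons x u)
  show ?case
  proof (cases w)
    case Nil
    then show ?thesis by (simp add: wmon_def)
  next
    case (Cons y w')
    have "(\<lambda>a. wmon c (x # u) (y # a)) = (if x = y then wmon c u else (\<lambda>a. 0))"
      by (auto simp: wmon_def)
    then show ?thesis
      using Cons.IH[of w'] Cons by (auto simp: wmon_def)
  qed
qed

lemma galg_simps:
  "f \<in> carrier (galg G) \<longleftrightarrow> finite {w. f w \<noteq> 0} \<and> (\<forall>w. f w \<noteq> 0 \<longrightarrow> set w \<subseteq> G)"
  "f \<otimes>\<^bsub>galg G\<^esub> g = conv f g"
  "\<one>\<^bsub>galg G\<^esub> = wmon 1 []"
  "\<zero>\<^bsub>galg G\<^esub> = (\<lambda>w. 0)"
  "f \<oplus>\<^bsub>galg G\<^esub> g = (\<lambda>w. f w + g w)"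
  by (auto simp: galg_def wmon_def conv_def)

lemma wmon_closed: "set u \<subseteq> G \<Longrightarrow> wmon c u \<in> carrier (galg G)"
  by (auto simp: galg_simps wmon_def)

lemma fgen_closed: "g \<in> G \<Longrightarrow> fgen g \<in> carrier (galg G)"
  by (simp add: fgen_eq_wmon wmon_closed)

lemma fsc_closed: "fsc c \<in> carrier (galg G)"
  by (simp add: fsc_eq_wmon wmon_closed)

lemma galg_add_closed:
  assumes "f \<in> carrier (galg G)" "g \<in> carrier (galg G)"
  shows "(\<lambda>w. f w + g w) \<in> carrier (galg G)"
proof -
  have "{w. f w + g w \<noteq> 0} \<subseteq> {w. f w \<noteq> 0} \<union> {w. g w \<noteq> 0}"
    by auto
  moreover have "finite ({w. f w \<noteq> 0} \<union> {w. g w \<noteq> 0})"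
    using assms unfolding galg_simps by blast
  ultimately have "finite {w. f w + g w \<noteq> 0}"
    by (rule finite_subset)
  moreover have "set w \<subseteq> G" if "f w + g w \<noteq> 0" for w
    using assms that unfolding galg_simps by (cases "f w = 0") simp_all
  ultimately show ?thesis
    unfolding galg_simps by blast
qed

lemma galg_uminus_closed:
  "f \<in> carrier (galg G) \<Longrightarrow> (\<lambda>w. - f w) \<in> carrier (galg G)"
  by (simp add: galg_simps)

lemma galg_zero_closed: "(\<lambda>w. 0) \<in> carrier (galg G)"
  by (simp add: galg_simps)

lemma conv_closed:
  assumes "f \<in> carrier (galg G)" "g \<in> carrier (galg G)"
  shows "conv f g \<in> carrier (galg G)"
proof -
  have *: "\<exists>u v. w = u @ v \<and> f u \<noteq> 0 \<and> g v \<noteq> 0" if "conv f g w \<noteq> 0" for w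
  proof -
    from that obtain i where "f (take i w) * g (drop i w) \<noteq> 0"
      unfolding conv_def by (meson sum.neutral)
    then show ?thesis
      by (metis append_take_drop_id mult_zero_left mult_zero_right)
  qed
  then have "{w. conv f g w \<noteq> 0} \<subseteq> (\<lambda>(u, v). u @ v) ` ({w. f w \<noteq> 0} \<times> {w. g w \<noteq> 0})"
    by fastforce
  moreover have "finite ((\<lambda>(u, v). u @ v) ` ({w. f w \<noteq> 0} \<times> {w. g w \<noteq> 0}))"
    using assms unfolding galg_simps by (intro finite_imageI finite_SigmaI) auto
  ultimately have "finite {w. conv f g w \<noteq> 0}"
    by (rule finite_subset)
  moreover have "set w \<subseteq> G" if "conv f g w \<noteq> 0" for w
    using *[OF that] assms unfolding galg_simps by (metis Un_subset_iff set_append)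
  ultimately show ?thesis
    by (simp add: galg_simps)
qed

lemma galg_ring: "ring (galg G :: ('g list \<Rightarrow> 'k::field) ring)"
proof (rule ringI)
  show "abelian_group (galg G :: ('g list \<Rightarrow> 'k) ring)"
  proof (rule abelian_groupI)
    show "\<exists>y\<in>carrier (galg G). y \<oplus>\<^bsub>galg G\<^esub> x = \<zero>\<^bsub>galg G\<^esub>"
      if "x \<in> carrier (galg G)" for x :: "'g list \<Rightarrow> 'k"
      using galg_uminus_closed[OF that] by (intro bexI[of _ "\<lambda>w. - x w"]) (simp_all add: galg_simps(4,5))
  qed (simp_all add: galg_simps(4,5) galg_add_closed galg_zero_closed ac_simps)
  show "Group.monoid (galg G :: ('g list \<Rightarrow> 'k) ring)"
    by (rule monoidI)
      (simp_all add: galg_simps(2,3) conv_closed wmon_closed fun_eq_iff conv_assoc conv_wmon_Nil conv_Nil_wmon)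
qed (simp_all add: galg_simps(2,5) fun_eq_iff conv_add_left conv_add_right)

lemma fsc_central_algebra:
  "central_algebra (galg G) (fsc :: 'k::field \<Rightarrow> 'g list \<Rightarrow> 'k)"
proof -
  interpret ring "galg G :: ('g list \<Rightarrow> 'k) ring" by (rule galg_ring)
  show ?thesis
    by unfold_locales
      (simp_all add: fsc_closed galg_simps(2-5), simp_all add: fsc_eq_wmon fun_eq_iff conv_wmon_Nil
          conv_Nil_wmon mult.commute wmon_closed, simp_all add: wmon_def)
qed

lemma galg_induct [consumes 1, case_names zero add]:
  assumes "f \<in> carrier (galg G)"
    and zero: "P \<zero>\<^bsub>galg G\<^esub>"
    and add: "\<And>f c u. f \<in> carrier (galg G) \<Longrightarrow> set u \<subseteq> G \<Longrightarrow> P f \<Longrightarrow> P (f \<oplus>\<^bsub>galg G\<^esub> wmon c u)"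
  shows "P f"
proof -
  \<comment> \<open>The support need only be contained in \<open>F\<close>; hence the monomial split
    off may have coefficient 0.\<close>
  have "P f" if "finite F" "\<And>w. w \<in> F \<Longrightarrow> set w \<subseteq> G" "\<And>w. f w \<noteq> 0 \<Longrightarrow> w \<in> F" for F f
    using that
  proof (induction F arbitrary: f rule: finite_induct)
    case empty
    then have "f = (\<lambda>w. 0)" by auto
    then show ?case using zero by (simp add: galg_simps)
  next
    case (insert u F)
    let ?f = "f(u := 0)"
    have sub: "{w. ?f w \<noteq> 0} \<subseteq> F"
      using insert.prems(2) by auto
    then have "?f \<in> carrier (galg G)"
      using insert.hyps(1) insert.prems(1) finite_subset unfolding galg_simps by blast
    moreover have "P ?f"
      using insert.IH[of ?f] insert.prems sub by blast
    ultimately have "P (?f \<oplus>\<^bsub>galg G\<^esub> wmon (f u) u)"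
      using add insert.prems(1) by blast
    moreover have "?f \<oplus>\<^bsub>galg G\<^esub> wmon (f u) u = f"
      by (auto simp: galg_simps wmon_def)
    ultimately show ?case by simp
  qed
  then show ?thesis
    using assms(1) unfolding galg_simps by blast
qed

section \<open>Evaluation of the free algebra at a family of ring elements\<close>

context central_algebra
begin

definition wordval :: "('g \<Rightarrow> 'a) \<Rightarrow> 'g list \<Rightarrow> 'a" where
  "wordval \<xi> u = foldr (\<lambda>g a. \<xi> g \<otimes> a) u \<one>"

definition freeval :: "('g \<Rightarrow> 'a) \<Rightarrow> ('g list \<Rightarrow> 'k) \<Rightarrow> 'a" where
  "freeval \<xi> f = (\<Oplus>u\<in>{u. f u \<noteq> 0}. s (f u) \<otimes> wordval \<xi> u)"

lemma wordval_closed: "\<xi> \<in> G \<rightarrow> carrier R \<Longrightarrow> set u \<subseteq> G \<Longrightarrow> wordval \<xi> u \<in> carrier R"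
  by (induction u) (auto simp: wordval_def)

lemma wordval_append:
  assumes "\<xi> \<in> G \<rightarrow> carrier R" "set u \<subseteq> G" "set v \<subseteq> G"
  shows "wordval \<xi> (u @ v) = wordval \<xi> u \<otimes> wordval \<xi> v"
  using assms(2)
proof (induction u)
  case Nil
  then show ?case
    using wordval_closed[OF assms(1,3)] by (simp add: wordval_def)
next
  case (Cons g u)
  then have "wordval \<xi> u \<in> carrier R" "\<xi> g \<in> carrier R"
    using wordval_closed[OF assms(1), of u] assms(1) by auto
  then show ?case
    using Cons wordval_closed[OF assms(1,3)]
    by (simp add: m_assoc wordval_def)
qed

context
  fixes \<xi> :: "'g \<Rightarrow> 'a" and G
  assumes \<xi>: "\<xi> \<in> G \<rightarrow> carrier R"
begin

text \<open>Words outside the support contribute 0. Additivity needs a common index set for both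
  summands, since the support of a sum can shrink by cancellation.\<close>

lemma freeval_superset:
  assumes "f \<in> carrier (galg G)" "finite F" "{u. f u \<noteq> 0} \<subseteq> F" "\<And>u. u \<in> F \<Longrightarrow> set u \<subseteq> G"
  shows "freeval \<xi> f = (\<Oplus>u\<in>F. s (f u) \<otimes> wordval \<xi> u)"
  unfolding freeval_def using assms wordval_closed[OF \<xi>]
  by (intro add.finprod_mono_neutral_cong_left) auto

lemma freeval_closed: "f \<in> carrier (galg G) \<Longrightarrow> freeval \<xi> f \<in> carrier R"
  unfolding freeval_def using wordval_closed[OF \<xi>]
  by (intro finsum_closed) (auto simp: galg_simps)

lemma freeval_add:
  assumes f: "f \<in> carrier (galg G)" and g: "g \<in> carrier (galg G)"
  shows "freeval \<xi> (f \<oplus>\<^bsub>galg G\<^esub> g) = freeval \<xi> f \<oplus> freeval \<xi> g"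
proof -
  let ?F = "{u. f u \<noteq> 0} \<union> {u. g u \<noteq> 0}"
  have F: "finite ?F" "\<And>u. u \<in> ?F \<Longrightarrow> set u \<subseteq> G"
    using f g by (auto simp: galg_simps)
  have fg: "(\<lambda>w. f w + g w) \<in> carrier (galg G)"
    by (rule galg_add_closed[OF f g])
  have "freeval \<xi> (\<lambda>w. f w + g w) = (\<Oplus>u\<in>?F. s (f u + g u) \<otimes> wordval \<xi> u)"
    by (rule freeval_superset[OF fg F(1) _ F(2)]) auto
  also have "\<dots> = (\<Oplus>u\<in>?F. s (f u) \<otimes> wordval \<xi> u \<oplus> s (g u) \<otimes> wordval \<xi> u)"
    using F(2) by (intro finsum_cong') (auto simp: s_add l_distr wordval_closed[OF \<xi>])
  also have "\<dots> = (\<Oplus>u\<in>?F. s (f u) \<otimes> wordval \<xi> u) \<oplus> (\<Oplus>u\<in>?F. s (g u) \<otimes> wordval \<xi> u)"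
    using F(2) wordval_closed[OF \<xi>] by (intro finsum_addf) auto
  also have "\<dots> = freeval \<xi> f \<oplus> freeval \<xi> g"
    using freeval_superset[OF f F(1) _ F(2)] freeval_superset[OF g F(1) _ F(2)] by auto
  finally show ?thesis
    by (simp add: galg_simps)
qed

lemma freeval_zero: "freeval \<xi> \<zero>\<^bsub>galg G\<^esub> = \<zero>"
  by (simp add: freeval_def galg_simps)

lemma freeval_wmon: "set u \<subseteq> G \<Longrightarrow> freeval \<xi> (wmon c u) = s c \<otimes> wordval \<xi> u"
proof -
  assume u: "set u \<subseteq> G"
  have "{v. wmon c u v \<noteq> 0} \<subseteq> {u}" by (auto simp: wmon_def)
  then have "freeval \<xi> (wmon c u) = (\<Oplus>v\<in>{u}. s (wmon c u v) \<otimes> wordval \<xi> v)"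
    by (intro freeval_superset[OF wmon_closed[OF u]]) (simp_all add: u)
  then show ?thesis
    using wordval_closed[OF \<xi> u] by (simp add: wmon_def)
qed

text \<open>Multiplicativity is linear in each factor, so it is reduced to monomials one factor at a
  time: the left factor here, the right one in \<open>freeval_ring_hom\<close>. For two monomials it
  rests on the centrality of the scalars.\<close>

lemma freeval_mult_wmon:
  assumes f: "f \<in> carrier (galg G)" and u: "set u \<subseteq> G"
  shows "freeval \<xi> (f \<otimes>\<^bsub>galg G\<^esub> wmon c u) = freeval \<xi> f \<otimes> freeval \<xi> (wmon c u)"
  using f
proof (induction f rule: galg_induct)
  case zero
  interpret F: ring "galg G :: ('g list \<Rightarrow> 'k) ring" by (rule galg_ring)
  show ?case
    using freeval_closed wmon_closed[OF u, of c] by (simp add: freeval_zero)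
next
  case (add f c' v)
  interpret F: ring "galg G :: ('g list \<Rightarrow> 'k) ring" by (rule galg_ring)
  have c: "wmon c' v \<in> carrier (galg G)" "wmon c u \<in> carrier (galg G)"
    using add u wmon_closed by blast+
  have "wmon c' v \<otimes>\<^bsub>galg G\<^esub> wmon c u = wmon (c' * c) (v @ u)"
    by (simp add: galg_simps fun_eq_iff conv_wmon_wmon)
  moreover have "wordval \<xi> v \<in> carrier R" "wordval \<xi> u \<in> carrier R"
    using wordval_closed[OF \<xi>] add u by auto
  ultimately have "freeval \<xi> (wmon c' v \<otimes>\<^bsub>galg G\<^esub> wmon c u) = freeval \<xi> (wmon c' v) \<otimes> freeval \<xi> (wmon c u)"
    using add u by (simp add: freeval_wmon wordval_append[OF \<xi>] s_mult_mult)
  then show ?case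
    using add c by (simp add: F.l_distr freeval_add freeval_closed l_distr)
qed

lemma freeval_ring_hom: "freeval \<xi> \<in> ring_hom (galg G) R"
proof (rule ring_hom_memI)
  interpret F: ring "galg G :: ('g list \<Rightarrow> 'k) ring" by (rule galg_ring)
  fix f g :: "'g list \<Rightarrow> 'k"
  assume f: "f \<in> carrier (galg G)" and g: "g \<in> carrier (galg G)"
  show "freeval \<xi> f \<in> carrier R" by (rule freeval_closed[OF f])
  show "freeval \<xi> (f \<oplus>\<^bsub>galg G\<^esub> g) = freeval \<xi> f \<oplus> freeval \<xi> g" by (rule freeval_add[OF f g])
  show "freeval \<xi> (f \<otimes>\<^bsub>galg G\<^esub> g) = freeval \<xi> f \<otimes> freeval \<xi> g"
    using g
  proof (induction g rule: galg_induct)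
    case zero
    show ?case
      using freeval_closed[OF f] f by (simp add: freeval_zero)
  next
    case (add g c u)
    then have c: "wmon c u \<in> carrier (galg G)" by (simp add: wmon_closed)
    show ?case
      using add c f freeval_mult_wmon[OF f]
      by (simp add: F.r_distr freeval_add freeval_closed r_distr)
  qed
next
  show "freeval \<xi> \<one>\<^bsub>galg G\<^esub> = \<one>"
    using freeval_wmon[of "[]" 1] by (simp add: galg_simps wordval_def)
qed

lemma freeval_fsc: "freeval \<xi> (fsc c) = s c"
  using freeval_wmon[of "[]" c] by (simp add: fsc_eq_wmon wordval_def)

lemma freeval_fgen: "g \<in> G \<Longrightarrow> freeval \<xi> (fgen g) = \<xi> g"
  using freeval_wmon[of "[g]" 1] funcset_mem[OF \<xi>, of g] by (simp add: fgen_eq_wmon wordval_def)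

end

end

section \<open>Presented algebras and their universal property\<close>

lemma genideal_galg_ideal:
  assumes "Rel \<subseteq> carrier (galg G)"
  shows "ideal (genideal (galg G) Rel) (galg G)"
  using ring.genideal_ideal[OF galg_ring assms] .

lemma pcls_ring_hom_ring:
  assumes "Rel \<subseteq> carrier (galg G)"
  shows "ring_hom_ring (galg G) (pres G Rel) (pcls G Rel)"
  using ideal.rcos_ring_hom_ring[OF genideal_galg_ideal[OF assms]]
  by (simp add: pres_def pcls_def[abs_def])

lemma pres_carrier: "carrier (pres G Rel) = pcls G Rel ` carrier (galg G)"
  by (auto simp: pres_def pcls_def FactRing_def A_RCOSETS_def')

lemma pres_central_algebra:
  assumes "Rel \<subseteq> carrier (galg G)"
  shows "central_algebra (pres G Rel) (\<lambda>c. pcls G Rel (fsc c))"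
proof -
  interpret F: central_algebra "galg G :: (_ \<Rightarrow> 'b) ring" fsc by (rule fsc_central_algebra)
  interpret H: ring_hom_ring "galg G" "pres G Rel" "pcls G Rel" by (rule pcls_ring_hom_ring[OF assms])
  show ?thesis
  proof unfold_locales
    fix a c assume "a \<in> carrier (pres G Rel)"
    then obtain f where f: "f \<in> carrier (galg G)" "a = pcls G Rel f"
      by (auto simp: pres_carrier)
    then show "pcls G Rel (fsc c) \<otimes>\<^bsub>pres G Rel\<^esub> a = a \<otimes>\<^bsub>pres G Rel\<^esub> pcls G Rel (fsc c)"
      using F.s_central[OF f(1), of c] by (simp flip: H.hom_mult)
  qed (simp_all add: F.s_add F.s_mult)
qed

lemma pcls_eq_if_diff_mem:
  assumes Rel: "Rel \<subseteq> carrier (galg G)" and f: "f \<in> carrier (galg G)" and g: "g \<in> carrier (galg G)"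
    and fg: "f \<ominus>\<^bsub>galg G\<^esub> g \<in> Rel"
  shows "pcls G Rel f = pcls G Rel g"
proof -
  interpret F: ring "galg G :: (_ \<Rightarrow> 'b) ring" by (rule galg_ring)
  interpret I: ideal "genideal (galg G) Rel" "galg G" by (rule genideal_galg_ideal[OF Rel])
  have "f \<ominus>\<^bsub>galg G\<^esub> g \<in> genideal (galg G) Rel"
    using F.genideal_self[OF Rel] fg by blast
  then show ?thesis
    unfolding pcls_def using F.quotient_eq_iff_same_a_r_cos[OF I.ideal_axioms f g] by simp
qed

lemma (in central_algebra) pres_lift:
  assumes Rel: "Rel \<subseteq> carrier (galg G)" and \<xi>: "\<xi> \<in> G \<rightarrow> carrier R"
    and zero: "\<And>f. f \<in> Rel \<Longrightarrow> freeval \<xi> f = \<zero>"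
  obtains \<psi> where "kalg_hom (pres G Rel) (\<lambda>c. pcls G Rel (fsc c)) R s \<psi>"
    and "\<And>g. g \<in> G \<Longrightarrow> \<psi> (pcls G Rel (fgen g)) = \<xi> g"
proof -
  interpret F: ring "galg G :: (_ \<Rightarrow> 'k) ring" by (rule galg_ring)
  interpret E: ring_hom_ring "galg G" R "freeval \<xi>"
    by (rule ring_hom_ringI2[OF galg_ring ring_axioms freeval_ring_hom[OF \<xi>]])
  interpret I: ideal "genideal (galg G) Rel" "galg G" by (rule genideal_galg_ideal[OF Rel])
  interpret H: ring_hom_ring "galg G" "pres G Rel" "pcls G Rel" by (rule pcls_ring_hom_ring[OF Rel])
  have ker: "genideal (galg G) Rel \<subseteq> a_kernel (galg G) R (freeval \<xi>)"
  proof (rule F.genideal_minimal[OF E.kernel_is_ideal])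
    show "Rel \<subseteq> a_kernel (galg G) R (freeval \<xi>)"
      using Rel zero unfolding a_kernel_def' by blast
  qed
  \<comment> \<open>A value is read off from an arbitrary representative; the inclusion
    \<open>ker\<close> makes it independent of the choice.\<close>
  define \<psi> where "\<psi> C = freeval \<xi> (SOME f. f \<in> carrier (galg G) \<and> pcls G Rel f = C)" for C
  have \<psi>: "\<psi> (pcls G Rel f) = freeval \<xi> f" if f: "f \<in> carrier (galg G)" for f
  proof -
    define g where "g = (SOME g. g \<in> carrier (galg G) \<and> pcls G Rel g = pcls G Rel f)"
    have g: "g \<in> carrier (galg G)" "pcls G Rel g = pcls G Rel f"
      unfolding g_def using someI[of "\<lambda>g. g \<in> carrier (galg G) \<and> pcls G Rel g = pcls G Rel f" f] f
      by auto
    then have "g \<ominus>\<^bsub>galg G\<^esub> f \<in> genideal (galg G) Rel"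
      using F.quotient_eq_iff_same_a_r_cos[OF I.ideal_axioms g(1) f] by (simp add: pcls_def)
    then have "freeval \<xi> (g \<ominus>\<^bsub>galg G\<^esub> f) = \<zero>"
      using ker unfolding a_kernel_def' by blast
    then have "freeval \<xi> g \<ominus> freeval \<xi> f = \<zero>"
      using f g(1) by (simp add: F.minus_eq minus_eq)
    then show ?thesis
      using f g(1) by (simp add: \<psi>_def g_def[symmetric])
  qed
  have "\<psi> \<in> ring_hom (pres G Rel) R"
  proof (rule ring_hom_memI)
    fix x y assume xy: "x \<in> carrier (pres G Rel)" "y \<in> carrier (pres G Rel)"
    then obtain f g where fg: "f \<in> carrier (galg G)" "x = pcls G Rel f"
      "g \<in> carrier (galg G)" "y = pcls G Rel g"
      by (auto simp: pres_carrier)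
    show "\<psi> x \<in> carrier R" using fg \<psi> by simp
    show "\<psi> (x \<otimes>\<^bsub>pres G Rel\<^esub> y) = \<psi> x \<otimes> \<psi> y"
      using fg \<psi> by (simp flip: H.hom_mult)
    show "\<psi> (x \<oplus>\<^bsub>pres G Rel\<^esub> y) = \<psi> x \<oplus> \<psi> y"
      using fg \<psi> by (simp flip: H.hom_add)
  next
    show "\<psi> \<one>\<^bsub>pres G Rel\<^esub> = \<one>"
      using \<psi>[OF F.one_closed] by simp
  qed
  then have "kalg_hom (pres G Rel) (\<lambda>c. pcls G Rel (fsc c)) R s \<psi>"
    using \<psi> by (simp add: kalg_hom_def fsc_closed freeval_fsc[OF \<xi>])
  moreover have "\<psi> (pcls G Rel (fgen g)) = \<xi> g" if "g \<in> G" for g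
    using that \<psi> by (simp add: fgen_closed freeval_fgen[OF \<xi>])
  ultimately show thesis using that by blast
qed

lemma (in central_algebra) pres_hom_unique:
  assumes Rel: "Rel \<subseteq> carrier (galg G)"
    and hom: "kalg_hom (pres G Rel) (\<lambda>c. pcls G Rel (fsc c)) R s \<phi>"
      "kalg_hom (pres G Rel) (\<lambda>c. pcls G Rel (fsc c)) R s \<psi>"
    and gen: "\<And>g. g \<in> G \<Longrightarrow> \<phi> (pcls G Rel (fgen g)) = \<psi> (pcls G Rel (fgen g))"
    and z: "z \<in> carrier (pres G Rel)"
  shows "\<phi> z = \<psi> z"
proof -
  interpret F: central_algebra "galg G :: (_ \<Rightarrow> 'k) ring" fsc by (rule fsc_central_algebra)
  interpret H: ring_hom_ring "galg G" "pres G Rel" "pcls G Rel" by (rule pcls_ring_hom_ring[OF Rel])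
  interpret A: ring_hom_ring "pres G Rel" R \<phi>
    using hom(1) by (intro ring_hom_ringI2 H.S.ring_axioms ring_axioms) (simp add: kalg_hom_def)
  interpret B: ring_hom_ring "pres G Rel" R \<psi>
    using hom(2) by (intro ring_hom_ringI2 H.S.ring_axioms ring_axioms) (simp add: kalg_hom_def)
  have word: "\<phi> (pcls G Rel (wmon c u)) = \<psi> (pcls G Rel (wmon c u))" if "set u \<subseteq> G" for c u
    using that
  \<comment> \<open>Removing letters from the right leaves the coefficient \<open>c\<close> with the
    shorter word, so the base case is the scalar \<open>c\<close>, on which any two algebra
    homomorphisms agree.\<close>
  proof (induction u rule: rev_induct)
    case Nil
    then show ?case using hom by (simp add: kalg_hom_def flip: fsc_eq_wmon)
  next
    case (snoc g u)
    have "wmon c (u @ [g]) = wmon c u \<otimes>\<^bsub>galg G\<^esub> fgen g"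
      by (simp add: galg_simps fun_eq_iff conv_wmon_wmon fgen_eq_wmon)
    moreover have "(fgen g :: _ \<Rightarrow> 'k) \<in> carrier (galg G)"
      using snoc.prems by (intro fgen_closed) simp
    ultimately show ?case
      using snoc gen[of g] wmon_closed[of u G c] by simp
  qed
  obtain f where f: "f \<in> carrier (galg G)" "z = pcls G Rel f"
    using z by (auto simp: pres_carrier)
  have "\<phi> (pcls G Rel f) = \<psi> (pcls G Rel f)"
    using f(1)
  proof (induction f rule: galg_induct)
    case (add f c u)
    then show ?case
      using word[of u c] wmon_closed[of u G c] by simp
  qed simp
  with f show ?thesis by simp
qed

section \<open>The algebras A(n,d,q)\<close>

text \<open>\<open>R\<close> need not be the presented algebra; only a family \<open>\<xi>\<close>
  obeying its relations is given. The locale is instantiated by the generators of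
  \<open>AA n d q\<close>, by the operators \<open>actop\<close>, and, with parameters
  \<open>r\<close> and \<open>qt\<close>, by the proposed images inside
  \<open>AA n d q\<close>.\<close>

locale weyl_relations = central_algebra R s for R :: "'a ring" (structure) and s :: "'k::field \<Rightarrow> 'a" +
  fixes n d :: nat and q :: "nat \<Rightarrow> 'k" and \<xi> :: "gen \<Rightarrow> 'a"
  assumes gen_closed: "g \<in> Agens n \<Longrightarrow> \<xi> g \<in> carrier R"
    and h_hi: "i \<in> {1..n} \<Longrightarrow> \<xi> (Gh i) \<otimes> \<xi> (Ghi i) = \<one>"
    and hi_h: "i \<in> {1..n} \<Longrightarrow> \<xi> (Ghi i) \<otimes> \<xi> (Gh i) = \<one>"
    and x_h: "i \<in> {1..n} \<Longrightarrow> \<xi> (Gx i) \<otimes> \<xi> (Gh i) = s (q i) \<otimes> \<xi> (Gh i) \<otimes> \<xi> (Gx i)"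
    and y_h: "i \<in> {1..n} \<Longrightarrow> \<xi> (Gy i) \<otimes> \<xi> (Gh i) = s (inverse (q i)) \<otimes> \<xi> (Gh i) \<otimes> \<xi> (Gy i)"
    and x_y: "i \<in> {1..n} \<Longrightarrow> \<xi> (Gx i) \<otimes> \<xi> (Gy i) = (s (q i) \<otimes> \<xi> (Gh i)) [^] d \<ominus> \<one>"
    and y_x: "i \<in> {1..n} \<Longrightarrow> \<xi> (Gy i) \<otimes> \<xi> (Gx i) = \<xi> (Gh i) [^] d \<ominus> \<one>"
    and gen_commute: "g \<in> Agens n \<Longrightarrow> g' \<in> Agens n \<Longrightarrow> gidx g \<noteq> gidx g' \<Longrightarrow> \<xi> g \<otimes> \<xi> g' = \<xi> g' \<otimes> \<xi> g"

lemma Agens_iff [simp]: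
  "Gx i \<in> Agens n \<longleftrightarrow> i \<in> {1..n}" "Gy i \<in> Agens n \<longleftrightarrow> i \<in> {1..n}"
  "Gh i \<in> Agens n \<longleftrightarrow> i \<in> {1..n}" "Ghi i \<in> Agens n \<longleftrightarrow> i \<in> {1..n}"
  by (simp_all add: Agens_def)

lemma Arels_closed: "Arels n d q \<subseteq> carrier (galg (Agens n))"
proof -
  interpret F: ring "galg (Agens n) :: (gen list \<Rightarrow> 'a) ring" by (rule galg_ring)
  show ?thesis
    by (auto simp: Arels_def fgen_closed fsc_closed)
qed

lemma AA_central_algebra: "central_algebra (AA n d q) (sA n d q)"
  using pres_central_algebra[OF Arels_closed[of n d q]]
  by (simp add: AA_def sA_def[abs_def] clA_def)

lemma AA_weyl_relations: "weyl_relations (AA n d q) (sA n d q) n d q (\<lambda>g. clA n d q (fgen g))"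
proof -
  let ?F = "galg (Agens n) :: (gen list \<Rightarrow> 'a) ring"
  interpret F: ring ?F by (rule galg_ring)
  interpret A: central_algebra "AA n d q" "sA n d q" by (rule AA_central_algebra)
  interpret H: ring_hom_ring ?F "AA n d q" "clA n d q"
    using pcls_ring_hom_ring[OF Arels_closed[of n d q]]
    by (simp add: AA_def clA_def[abs_def])
  have eq: "clA n d q f = clA n d q g"
    if "f \<ominus>\<^bsub>?F\<^esub> g \<in> Arels n d q" "f \<in> carrier ?F" "g \<in> carrier ?F" for f g
    unfolding clA_def using pcls_eq_if_diff_mem[OF Arels_closed that(2,3,1)] .
  have gen: "fgen g \<in> carrier ?F" if "g \<in> Agens n" for g
    by (rule fgen_closed[OF that])
  have sc: "fsc c \<in> carrier ?F" for c
    by (rule fsc_closed)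
  have hom_minus: "clA n d q (f \<ominus>\<^bsub>?F\<^esub> g) = clA n d q f \<ominus>\<^bsub>AA n d q\<^esub> clA n d q g"
    if "f \<in> carrier ?F" "g \<in> carrier ?F" for f g
    using that by (simp add: F.minus_eq A.minus_eq)
  note [simp] = gen sc hom_minus H.hom_nat_pow sA_def
  show ?thesis
  proof unfold_locales
    fix i assume i: "i \<in> {1..n}"
    have c: "Gx i \<in> Agens n" "Gy i \<in> Agens n" "Gh i \<in> Agens n" "Ghi i \<in> Agens n"
      using i by simp_all
    note [simp] = c[THEN gen]
    have "clA n d q (fgen (Gh i) \<otimes>\<^bsub>?F\<^esub> fgen (Ghi i)) = clA n d q \<one>\<^bsub>?F\<^esub>"
      by (rule eq) (use i in \<open>auto simp: Arels_def\<close>)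
    then show "clA n d q (fgen (Gh i)) \<otimes>\<^bsub>AA n d q\<^esub> clA n d q (fgen (Ghi i)) = \<one>\<^bsub>AA n d q\<^esub>"
      by simp
    have "clA n d q (fgen (Ghi i) \<otimes>\<^bsub>?F\<^esub> fgen (Gh i)) = clA n d q \<one>\<^bsub>?F\<^esub>"
      by (rule eq) (use i in \<open>auto simp: Arels_def\<close>)
    then show "clA n d q (fgen (Ghi i)) \<otimes>\<^bsub>AA n d q\<^esub> clA n d q (fgen (Gh i)) = \<one>\<^bsub>AA n d q\<^esub>"
      by simp
    have "clA n d q (fgen (Gx i) \<otimes>\<^bsub>?F\<^esub> fgen (Gh i))
        = clA n d q (fsc (q i) \<otimes>\<^bsub>?F\<^esub> fgen (Gh i) \<otimes>\<^bsub>?F\<^esub> fgen (Gx i))"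
      by (rule eq) (use i in \<open>auto simp: Arels_def\<close>)
    then show "clA n d q (fgen (Gx i)) \<otimes>\<^bsub>AA n d q\<^esub> clA n d q (fgen (Gh i))
        = sA n d q (q i) \<otimes>\<^bsub>AA n d q\<^esub> clA n d q (fgen (Gh i)) \<otimes>\<^bsub>AA n d q\<^esub> clA n d q (fgen (Gx i))"
      by simp
    have "clA n d q (fgen (Gy i) \<otimes>\<^bsub>?F\<^esub> fgen (Gh i))
        = clA n d q (fsc (inverse (q i)) \<otimes>\<^bsub>?F\<^esub> fgen (Gh i) \<otimes>\<^bsub>?F\<^esub> fgen (Gy i))"
      by (rule eq) (use i in \<open>auto simp: Arels_def\<close>)
    then show "clA n d q (fgen (Gy i)) \<otimes>\<^bsub>AA n d q\<^esub> clA n d q (fgen (Gh i))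
        = sA n d q (inverse (q i)) \<otimes>\<^bsub>AA n d q\<^esub> clA n d q (fgen (Gh i)) \<otimes>\<^bsub>AA n d q\<^esub> clA n d q (fgen (Gy i))"
      by simp
    have "clA n d q (fgen (Gx i) \<otimes>\<^bsub>?F\<^esub> fgen (Gy i))
        = clA n d q ((fsc (q i) \<otimes>\<^bsub>?F\<^esub> fgen (Gh i)) [^]\<^bsub>?F\<^esub> d \<ominus>\<^bsub>?F\<^esub> \<one>\<^bsub>?F\<^esub>)"
      by (rule eq) (use i in \<open>auto simp: Arels_def\<close>)
    then show "clA n d q (fgen (Gx i)) \<otimes>\<^bsub>AA n d q\<^esub> clA n d q (fgen (Gy i))
        = (sA n d q (q i) \<otimes>\<^bsub>AA n d q\<^esub> clA n d q (fgen (Gh i))) [^]\<^bsub>AA n d q\<^esub> d \<ominus>\<^bsub>AA n d q\<^esub> \<one>\<^bsub>AA n d q\<^esub>"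
      by simp
    have "clA n d q (fgen (Gy i) \<otimes>\<^bsub>?F\<^esub> fgen (Gx i))
        = clA n d q (fgen (Gh i) [^]\<^bsub>?F\<^esub> d \<ominus>\<^bsub>?F\<^esub> \<one>\<^bsub>?F\<^esub>)"
      by (rule eq) (use i in \<open>auto simp: Arels_def\<close>)
    then show "clA n d q (fgen (Gy i)) \<otimes>\<^bsub>AA n d q\<^esub> clA n d q (fgen (Gx i))
        = clA n d q (fgen (Gh i)) [^]\<^bsub>AA n d q\<^esub> d \<ominus>\<^bsub>AA n d q\<^esub> \<one>\<^bsub>AA n d q\<^esub>"
      by simp
  next
    fix g g' assume g: "g \<in> Agens n" "g' \<in> Agens n" "gidx g \<noteq> gidx g'"
    have "clA n d q (fgen g \<otimes>\<^bsub>?F\<^esub> fgen g') = clA n d q (fgen g' \<otimes>\<^bsub>?F\<^esub> fgen g)"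
      by (rule eq) (use g in \<open>auto simp: Arels_def\<close>)
    then show "clA n d q (fgen g) \<otimes>\<^bsub>AA n d q\<^esub> clA n d q (fgen g')
        = clA n d q (fgen g') \<otimes>\<^bsub>AA n d q\<^esub> clA n d q (fgen g)"
      using g by simp
  qed simp
qed

lemma (in weyl_relations) AA_lift:
  obtains \<psi> where "kalg_hom (AA n d q) (sA n d q) R s \<psi>"
    and "\<And>g. g \<in> Agens n \<Longrightarrow> \<psi> (clA n d q (fgen g)) = \<xi> g"
proof -
  let ?F = "galg (Agens n) :: (gen list \<Rightarrow> 'k) ring"
  have \<xi>: "\<xi> \<in> Agens n \<rightarrow> carrier R"
    using gen_closed by blast
  interpret F: ring ?F by (rule galg_ring)
  interpret E: ring_hom_ring ?F R "freeval \<xi>"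
    by (rule ring_hom_ringI2[OF galg_ring ring_axioms freeval_ring_hom[OF \<xi>]])
  have zero: "freeval \<xi> (f \<ominus>\<^bsub>?F\<^esub> g) = \<zero>"
    if "f \<in> carrier ?F" "g \<in> carrier ?F" "freeval \<xi> f = freeval \<xi> g" for f g
    using that by (simp add: F.minus_eq r_neg)
  have hom_minus: "freeval \<xi> (f \<ominus>\<^bsub>?F\<^esub> g) = freeval \<xi> f \<ominus> freeval \<xi> g"
    if "f \<in> carrier ?F" "g \<in> carrier ?F" for f g
    using that by (simp add: F.minus_eq minus_eq)
  note [simp] = fgen_closed fsc_closed hom_minus E.hom_nat_pow freeval_fsc[OF \<xi>] freeval_fgen[OF \<xi>] gen_closed
  have "freeval \<xi> f = \<zero>" if "f \<in> Arels n d q" for f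
    \<comment> \<open>The outer difference of a relation is first turned into an equation by
      \<open>zero\<close>; only then is \<open>hom_minus\<close> applied, to the inner differences
      in the relations for x y and y x.\<close>
    using that h_hi hi_h x_h y_h x_y y_x gen_commute
    unfolding Arels_def by (elim UnE UN_E insertE emptyE CollectE exE conjE) (simp_all add: zero del: hom_minus, simp_all)
  then show thesis
    using pres_lift[OF Arels_closed \<xi>] that
    unfolding AA_def sA_def[abs_def] clA_def[abs_def] by metis
qed

section \<open>A faithful action of Laurent polynomials\<close>

definition linops :: "(('e \<Rightarrow> 'k::field) \<Rightarrow> ('e \<Rightarrow> 'k)) ring" where
  "linops = \<lparr>carrier = {T. (\<forall>F G. T (\<lambda>e. F e + G e) = (\<lambda>e. T F e + T G e)) \<and>
       (\<forall>c F. T (\<lambda>e. c * F e) = (\<lambda>e. c * T F e))},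
     monoid.mult = (\<circ>), monoid.one = id, ring.zero = (\<lambda>F e. 0), ring.add = (\<lambda>S T F e. S F e + T F e)\<rparr>"

lemma linops_simps:
  "T \<in> carrier linops \<longleftrightarrow> (\<forall>F G. T (\<lambda>e. F e + G e) = (\<lambda>e. T F e + T G e)) \<and>
     (\<forall>c F. T (\<lambda>e. c * F e) = (\<lambda>e. c * T F e))"
  "S \<otimes>\<^bsub>linops\<^esub> T = S \<circ> T" "\<one>\<^bsub>linops\<^esub> = id" "\<zero>\<^bsub>linops\<^esub> = (\<lambda>F e. 0)"
  "S \<oplus>\<^bsub>linops\<^esub> T = (\<lambda>F e. S F e + T F e)"
  by (simp_all add: linops_def)

lemma linops_ring: "ring (linops :: (('e \<Rightarrow> 'k::field) \<Rightarrow> 'e \<Rightarrow> 'k) ring)"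
proof (rule ringI)
  show "abelian_group (linops :: (('e \<Rightarrow> 'k) \<Rightarrow> 'e \<Rightarrow> 'k) ring)"
  proof (rule abelian_groupI)
    fix T :: "('e \<Rightarrow> 'k) \<Rightarrow> 'e \<Rightarrow> 'k" assume "T \<in> carrier linops"
    then show "\<exists>S\<in>carrier linops. S \<oplus>\<^bsub>linops\<^esub> T = \<zero>\<^bsub>linops\<^esub>"
      by (intro bexI[of _ "\<lambda>F e. - T F e"]) (auto simp: linops_simps)
  qed (auto simp: linops_simps fun_eq_iff algebra_simps)
  show "Group.monoid (linops :: (('e \<Rightarrow> 'k) \<Rightarrow> 'e \<Rightarrow> 'k) ring)"
    by (rule monoidI) (auto simp: linops_simps)
qed (auto simp: linops_simps fun_eq_iff)

lemma linops_central_algebra: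
  "central_algebra (linops :: (('e \<Rightarrow> 'k::field) \<Rightarrow> 'e \<Rightarrow> 'k) ring) (\<lambda>c F e. c * F e)"
proof -
  interpret ring "linops :: (('e \<Rightarrow> 'k) \<Rightarrow> 'e \<Rightarrow> 'k) ring" by (rule linops_ring)
  show ?thesis
    by unfold_locales (auto simp: linops_simps fun_eq_iff algebra_simps)
qed

text \<open>Subtraction in a ring is defined through an additive inverse characterised only by its
  property. The pointwise difference \<open>D\<close> is therefore identified by cancelling
  \<open>T\<close> from \<open>D\<close> + \<open>T\<close> = \<open>S\<close>.\<close>

lemma linops_minus:
  assumes "S \<in> carrier linops" "T \<in> carrier linops"
  shows "S \<ominus>\<^bsub>linops\<^esub> T = (\<lambda>F e. S F e - T F e)"
proof -
  interpret ring linops by (rule linops_ring)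
  define D where "D = (\<lambda>F e. S F e - T F e)"
  have "D \<in> carrier linops"
    using assms by (auto simp: linops_simps D_def algebra_simps)
  then have "(D \<oplus>\<^bsub>linops\<^esub> T) \<ominus>\<^bsub>linops\<^esub> T = D"
    using assms(2) by (simp add: minus_eq a_assoc r_neg)
  moreover have "D \<oplus>\<^bsub>linops\<^esub> T = S"
    by (simp add: linops_simps D_def)
  ultimately show ?thesis
    by (simp add: D_def)
qed

definition shift :: "nat \<Rightarrow> int \<Rightarrow> ((nat \<Rightarrow> int) \<Rightarrow> 'k::field) \<Rightarrow> (nat \<Rightarrow> int) \<Rightarrow> 'k" where
  "shift i j F = (\<lambda>e. F (e(i := e i - j)))"

definition dilate :: "nat \<Rightarrow> 'k \<Rightarrow> ((nat \<Rightarrow> int) \<Rightarrow> 'k::field) \<Rightarrow> (nat \<Rightarrow> int) \<Rightarrow> 'k" where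
  "dilate i c F = (\<lambda>e. c powi e i * F e)"

text \<open>Functions on \<open>\<int>\<^sup>n\<close> are read as two-sided formal series in the \<open>h\<^sub>i\<close>: each \<open>h\<^sub>i\<close> multiplies,
  \<open>x\<^sub>i\<close> substitutes \<open>q\<^sub>i h\<^sub>i\<close> for \<open>h\<^sub>i\<close>, and \<open>y\<^sub>i\<close> is \<open>(h\<^sub>i\<^sup>d - 1) x\<^sub>i\<^sup>-\<^sup>1\<close>.\<close>
fun actop :: "nat \<Rightarrow> (nat \<Rightarrow> 'k) \<Rightarrow> gen \<Rightarrow> ((nat \<Rightarrow> int) \<Rightarrow> 'k::field) \<Rightarrow> (nat \<Rightarrow> int) \<Rightarrow> 'k" where
  "actop d q (Gx i) = dilate i (q i)"
| "actop d q (Gy i) = (\<lambda>F e. shift i (int d) (dilate i (inverse (q i)) F) e - dilate i (inverse (q i)) F e)"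
| "actop d q (Gh i) = shift i 1"
| "actop d q (Ghi i) = shift i (- 1)"

lemma shift_closed: "shift i j \<in> carrier linops"
  by (simp add: linops_simps shift_def)

lemma shift_pow: "shift i j [^]\<^bsub>linops\<^esub> (m::nat) = shift i (int m * j)"
  by (induction m) (simp_all add: nat_pow_def linops_simps shift_def fun_eq_iff algebra_simps)

lemma actop_closed: "actop d q g \<in> carrier linops"
  by (cases g) (auto simp: linops_simps shift_def dilate_def fun_eq_iff algebra_simps)

lemma linops_weyl_relations:
  assumes q: "\<And>i. i \<in> {1..n} \<Longrightarrow> q i \<noteq> 0"
  shows "weyl_relations linops (\<lambda>c F e. c * F e) n d q (actop d q)"
proof -
  interpret L: central_algebra linops "\<lambda>c F (e :: nat \<Rightarrow> int). c * F e" by (rule linops_central_algebra)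
  have pow: "((\<lambda>F e. c * F e) \<otimes>\<^bsub>linops\<^esub> shift i 1) [^]\<^bsub>linops\<^esub> d = (\<lambda>F e. c ^ d * shift i (int d) F e)"
    for c :: 'a and i
    by (induction d) (simp_all add: linops_simps shift_def fun_eq_iff algebra_simps)
  show ?thesis
  proof unfold_locales
    fix i assume "i \<in> {1..n}"
    then have qi: "q i \<noteq> 0" by (rule q)
    note sms = actop.simps linops_simps(2,3) shift_def dilate_def fun_eq_iff o_apply
    show "actop d q (Gh i) \<otimes>\<^bsub>linops\<^esub> actop d q (Ghi i) = \<one>\<^bsub>linops\<^esub>"
      by (simp add: sms)
    show "actop d q (Ghi i) \<otimes>\<^bsub>linops\<^esub> actop d q (Gh i) = \<one>\<^bsub>linops\<^esub>"
      by (simp add: sms)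
    show "actop d q (Gx i) \<otimes>\<^bsub>linops\<^esub> actop d q (Gh i) = (\<lambda>F e. q i * F e) \<otimes>\<^bsub>linops\<^esub> actop d q (Gh i) \<otimes>\<^bsub>linops\<^esub> actop d q (Gx i)"
      using qi by (simp add: sms power_int_diff)
    show "actop d q (Gy i) \<otimes>\<^bsub>linops\<^esub> actop d q (Gh i) = (\<lambda>F e. inverse (q i) * F e) \<otimes>\<^bsub>linops\<^esub> actop d q (Gh i) \<otimes>\<^bsub>linops\<^esub> actop d q (Gy i)"
      using qi by (simp add: sms power_int_diff power_int_inverse field_simps)
    show "actop d q (Gx i) \<otimes>\<^bsub>linops\<^esub> actop d q (Gy i) = ((\<lambda>F e. q i * F e) \<otimes>\<^bsub>linops\<^esub> actop d q (Gh i)) [^]\<^bsub>linops\<^esub> d \<ominus>\<^bsub>linops\<^esub> \<one>\<^bsub>linops\<^esub>"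
    proof -
      have "(\<lambda>F e. q i ^ d * shift i (int d) F e) \<in> carrier linops"
        by (simp add: linops_simps shift_def fun_eq_iff algebra_simps)
      then show ?thesis
        using qi by (simp add: pow linops_minus, simp add: sms power_int_diff power_int_inverse field_simps)
    qed
    show "actop d q (Gy i) \<otimes>\<^bsub>linops\<^esub> actop d q (Gx i) = actop d q (Gh i) [^]\<^bsub>linops\<^esub> d \<ominus>\<^bsub>linops\<^esub> \<one>\<^bsub>linops\<^esub>"
      using qi by (simp add: shift_pow linops_minus shift_closed, simp add: sms power_int_diff power_int_inverse field_simps)
  next
    fix g g' assume "gidx g \<noteq> gidx g'"
    then show "actop d q g \<otimes>\<^bsub>linops\<^esub> actop d q g' = actop d q g' \<otimes>\<^bsub>linops\<^esub> actop d q g"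
      by (cases g; cases g') (simp_all add: linops_simps shift_def dilate_def fun_eq_iff fun_upd_twist algebra_simps)
  qed (simp add: actop_closed)
qed

section \<open>Commutation up to scalars\<close>

context central_algebra
begin

text \<open>Membership in the carrier is included so that rules can be chained without separate
  closure conditions.\<close>

definition qcomm :: "'k \<Rightarrow> 'a \<Rightarrow> 'a \<Rightarrow> bool" where
  "qcomm c a b \<longleftrightarrow> a \<in> carrier R \<and> b \<in> carrier R \<and> a \<otimes> b = s c \<otimes> (b \<otimes> a)"

lemma qcommD: "qcomm c a b \<Longrightarrow> a \<otimes> b = s c \<otimes> (b \<otimes> a)"
  and qcomm_closed: "qcomm c a b \<Longrightarrow> a \<in> carrier R" "qcomm c a b \<Longrightarrow> b \<in> carrier R"
  by (simp_all add: qcomm_def)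

lemma qcomm_one_iff: "qcomm 1 a b \<longleftrightarrow> a \<in> carrier R \<and> b \<in> carrier R \<and> a \<otimes> b = b \<otimes> a"
  by (auto simp: qcomm_def)

lemma qcomm_mult_right:
  assumes "qcomm c a b" "qcomm c' a b'"
  shows "qcomm (c * c') a (b \<otimes> b')"
proof -
  note cl = qcomm_closed[OF assms(1)] qcomm_closed[OF assms(2)]
  have "a \<otimes> (b \<otimes> b') = s c \<otimes> (b \<otimes> (a \<otimes> b'))"
    using cl qcommD[OF assms(1)] by (simp flip: m_assoc)
  also have "\<dots> = s c \<otimes> (s c' \<otimes> (b \<otimes> (b' \<otimes> a)))"
    using cl by (simp add: qcommD[OF assms(2)] s_central_assoc[of b])
  finally show ?thesis
    using cl by (simp add: qcomm_def s_mult m_assoc)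
qed

lemma qcomm_mult_left:
  assumes "qcomm c a b" "qcomm c' a' b"
  shows "qcomm (c * c') (a \<otimes> a') b"
proof -
  note cl = qcomm_closed[OF assms(1)] qcomm_closed[OF assms(2)]
  have "a \<otimes> a' \<otimes> b = s c' \<otimes> ((a \<otimes> b) \<otimes> a')"
    using cl by (simp add: qcommD[OF assms(2)] s_central_assoc[of a] m_assoc)
  also have "\<dots> = s c' \<otimes> (s c \<otimes> (b \<otimes> (a \<otimes> a')))"
    using cl by (simp add: qcommD[OF assms(1)] m_assoc)
  also have "\<dots> = s (c * c') \<otimes> (b \<otimes> (a \<otimes> a'))"
    using cl by (simp add: mult.commute[of c] s_mult m_assoc)
  finally show ?thesis
    using cl by (simp add: qcomm_def)
qed

text \<open>Fitted to the four factors of \<open>xform\<close>. The total scalar enters through an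
  equation, so that it can be simplified after the rule has been applied.\<close>

lemma qcomm_mult4_right:
  assumes "qcomm c\<^sub>1 a b\<^sub>1" "qcomm c\<^sub>2 a b\<^sub>2" "qcomm c\<^sub>3 a b\<^sub>3" "qcomm c\<^sub>4 a b\<^sub>4"
    and "c = c\<^sub>1 * c\<^sub>2 * c\<^sub>3 * c\<^sub>4"
  shows "qcomm c a (b\<^sub>1 \<otimes> b\<^sub>2 \<otimes> b\<^sub>3 \<otimes> b\<^sub>4)"
  using assms by (simp add: qcomm_mult_right)

lemma qcomm_mult4_left:
  assumes "qcomm c\<^sub>1 a\<^sub>1 b" "qcomm c\<^sub>2 a\<^sub>2 b" "qcomm c\<^sub>3 a\<^sub>3 b" "qcomm c\<^sub>4 a\<^sub>4 b"
    and "c = c\<^sub>1 * c\<^sub>2 * c\<^sub>3 * c\<^sub>4"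
  shows "qcomm c (a\<^sub>1 \<otimes> a\<^sub>2 \<otimes> a\<^sub>3 \<otimes> a\<^sub>4) b"
  using assms by (simp add: qcomm_mult_left)

lemma qcomm_sym:
  assumes "qcomm c a b" "c \<noteq> 0"
  shows "qcomm (inverse c) b a"
  using qcomm_closed[OF assms(1)] assms(2)
  by (simp add: qcomm_def qcommD[OF assms(1)] flip: m_assoc)

lemma qcomm_one_sym: "qcomm 1 a b \<Longrightarrow> qcomm 1 b a"
  by (simp add: qcomm_one_iff)

lemma qcomm_scalar [simp]:
  "b \<in> carrier R \<Longrightarrow> qcomm 1 (s c) b" "a \<in> carrier R \<Longrightarrow> qcomm 1 a (s c)"
  "a \<in> carrier R \<Longrightarrow> qcomm 1 a \<one>"
  using s_central[of a] s_central[of b] by (simp_all add: qcomm_one_iff)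

lemma qcomm_pow_right: "qcomm c a b \<Longrightarrow> qcomm (c ^ m) a (b [^] (m::nat))"
proof (induction m)
  case (Suc m)
  from qcomm_mult_right[OF Suc.IH[OF Suc.prems] Suc.prems] show ?case
    by (simp add: mult.commute)
qed (auto dest: qcomm_closed)

lemma qcomm_inv_right:
  assumes ab: "qcomm c a b" and c: "c \<noteq> 0" and b': "b' \<in> carrier R" "b \<otimes> b' = \<one>" "b' \<otimes> b = \<one>"
  shows "qcomm (inverse c) a b'"
proof -
  note cl = qcomm_closed[OF ab] b'(1)
  \<comment> \<open>Inserting \<open>b'\<close> \<open>b\<close> = 1 on the left produces
    \<open>b\<close> \<open>a\<close>, which can be swapped at the cost of the inverse
    scalar.\<close>
  have "a \<otimes> b' = (b' \<otimes> (b \<otimes> a)) \<otimes> b'"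
    using cl b'(3) by (simp flip: m_assoc)
  also have "\<dots> = b' \<otimes> (s (inverse c) \<otimes> (a \<otimes> b)) \<otimes> b'"
    using qcommD[OF qcomm_sym[OF ab c]] by simp
  also have "\<dots> = s (inverse c) \<otimes> (b' \<otimes> (a \<otimes> (b \<otimes> b')))"
    using cl by (simp add: s_central_assoc[of b'] m_assoc)
  finally show ?thesis
    using cl b'(2) by (simp add: qcomm_def)
qed

end

section \<open>Laurent polynomials in the elements h\<close>

text \<open>The exponent \<open>k\<close> may already occur in \<open>p\<close>, so a linear
  identity has to be checked on single monomials only.\<close>

lemma poly_mapping_induct [case_names zero add]:
  fixes p :: "'a \<Rightarrow>\<^sub>0 'b::monoid_add"
  assumes "P 0" "\<And>p k v. P p \<Longrightarrow> P (p + Poly_Mapping.single k v)"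
  shows "P p"
proof (induction p rule: update_induct)
  case const
  show ?case by (fact assms(1))
next
  case (update p k v)
  have "Poly_Mapping.update k v p = p + Poly_Mapping.single k v"
    using update.hyps(1) by (intro poly_mapping_eqI) (auto simp: lookup_update lookup_add lookup_single in_keys_iff)
  then show ?case using assms(2)[OF update.IH] by simp
qed

text \<open>The substitution p(X) -> p(cX), in terms of coefficients.\<close>

definition subst_scale :: "'k \<Rightarrow> (int \<Rightarrow>\<^sub>0 'k::field) \<Rightarrow> (int \<Rightarrow>\<^sub>0 'k)" where
  "subst_scale c p = Poly_Mapping.mapp (\<lambda>j a. c powi j * a) p"

lemma lookup_subst_scale [simp]:
  "Poly_Mapping.lookup (subst_scale c p) j = c powi j * Poly_Mapping.lookup p j"
  by (simp add: subst_scale_def lookup_mapp when_def in_keys_iff)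

lemma subst_scale_simps:
  "subst_scale c 0 = 0"
  "subst_scale c (p + p') = subst_scale c p + subst_scale c p'"
  "subst_scale c (p - p') = subst_scale c p - subst_scale c p'"
  "subst_scale c (Poly_Mapping.single j a) = Poly_Mapping.single j (c powi j * a)"
  "subst_scale c 1 = 1"
  by (intro poly_mapping_eqI; simp add: lookup_add lookup_minus lookup_single lookup_one algebra_simps when_def)+

lemma subst_scale_one [simp]: "subst_scale 1 p = p"
  by (intro poly_mapping_eqI) simp

lemma subst_scale_mult:
  assumes "c \<noteq> 0"
  shows "subst_scale c (p * p') = subst_scale c p * subst_scale c p'"
proof (induction p rule: poly_mapping_induct)
  case (add p k v)
  have "subst_scale c (Poly_Mapping.single k v * p') = subst_scale c (Poly_Mapping.single k v) * subst_scale c p'"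
    by (induction p' rule: poly_mapping_induct)
      (simp_all add: subst_scale_simps mult_single distrib_left power_int_add assms mult_ac)
  with add show ?case
    by (simp add: subst_scale_simps distrib_right)
qed (simp add: subst_scale_simps)

text \<open>The polynomial \<open>a\<^sub>d(c X\<^sup>j)\<close>.\<close>
definition apoly :: "nat \<Rightarrow> 'k \<Rightarrow> int \<Rightarrow> (int \<Rightarrow>\<^sub>0 'k::field)" where
  "apoly d c j = Poly_Mapping.single (int d * j) (c ^ d) - 1"

lemma subst_scale_apoly: "subst_scale c (apoly d c' j) = apoly d (c powi j * c') j"
  by (simp add: apoly_def subst_scale_simps power_mult_distrib power_int_mult mult.commute[of _ j])

section \<open>Integer powers, Laurent evaluation and monomials in the h\<close>

context weyl_relations
begin

abbreviation "h i \<equiv> \<xi> (Gh i)"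
abbreviation "hi i \<equiv> \<xi> (Ghi i)"

text \<open>\<open>hz\<close>, \<open>laurent\<close> and \<open>hzmono\<close> are
  \<open>hpow\<close>, \<open>lev\<close> and \<open>hmono\<close> for an arbitrary family
  satisfying the relations; for the generators of \<open>AA n d q\<close> the definitions agree on
  unfolding.\<close>

definition hz :: "nat \<Rightarrow> int \<Rightarrow> 'a" where
  "hz i e = (if 0 \<le> e then h i [^] nat e else hi i [^] nat (- e))"

definition laurent :: "(int \<Rightarrow>\<^sub>0 'k) \<Rightarrow> nat \<Rightarrow> 'a" where
  "laurent p i = (\<Oplus>j\<in>Poly_Mapping.keys p. s (Poly_Mapping.lookup p j) \<otimes> hz i j)"

definition hzmono :: "(nat \<Rightarrow> int) \<Rightarrow> 'a" where
  "hzmono e = foldr (\<lambda>j acc. hz j (e j) \<otimes> acc) [1..<n+1] \<one>"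

lemma h_closed [simp]: "i \<in> {1..n} \<Longrightarrow> h i \<in> carrier R"
  and hi_closed [simp]: "i \<in> {1..n} \<Longrightarrow> hi i \<in> carrier R"
  by (auto intro: gen_closed)

lemma hz_closed [simp]: "i \<in> {1..n} \<Longrightarrow> hz i e \<in> carrier R"
  unfolding hz_def by (metis h_closed hi_closed nat_pow_closed)

lemma hz_0 [simp]: "hz i 0 = \<one>"
  and hz_1: "i \<in> {1..n} \<Longrightarrow> hz i 1 = h i"
  by (simp_all add: hz_def del: atLeastAtMost_iff)

lemma hz_Suc:
  assumes i: "i \<in> {1..n}"
  shows "hz i (e + 1) = h i \<otimes> hz i e"
proof (cases "0 \<le> e")
  case True
  then have "nat (e + 1) = Suc (nat e)" by simp
  with True show ?thesis
    using nat_pow_Suc2[OF h_closed[OF i], of "nat e"] by (simp add: hz_def)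
next
  case False
  define m where "m = nat (- e - 1)"
  \<comment> \<open>The boundary is e = -1: then \<open>e + 1\<close> = 0 falls into the branch of
    nonnegative exponents, and the remaining power of \<open>hi i\<close> is trivial because
    \<open>m\<close> = 0.\<close>
  have e: "nat (- e) = Suc m" "nat (- (e + 1)) = m" "e + 1 \<noteq> 0 \<Longrightarrow> \<not> 0 \<le> e + 1" "e + 1 = 0 \<Longrightarrow> m = 0"
    using False by (auto simp: m_def)
  have "h i \<otimes> hi i [^] Suc m = h i \<otimes> (hi i \<otimes> hi i [^] m)"
    using nat_pow_Suc2[OF hi_closed[OF i], of m] by simp
  also have "\<dots> = hi i [^] m"
    using h_hi[OF i] i by (simp del: atLeastAtMost_iff flip: m_assoc)
  finally show ?thesis
    using False e by (cases "e + 1 = 0") (auto simp: hz_def)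
qed

lemma hz_add:
  assumes i: "i \<in> {1..n}"
  shows "hz i (j + k) = hz i j \<otimes> hz i k"
proof (induction j rule: int_induct[where k = 0])
  case base
  show ?case using i by (simp del: atLeastAtMost_iff)
next
  case (step1 j)
  have "hz i (j + 1 + k) = h i \<otimes> hz i (j + k)"
    using hz_Suc[OF i, of "j + k"] by (simp add: algebra_simps)
  then show ?case
    using i step1 by (simp add: hz_Suc m_assoc del: atLeastAtMost_iff)
next
  case (step2 j)
  \<comment> \<open>\<open>hz_Suc\<close> only raises exponents, so the claim is first proved with
    an extra factor \<open>h i\<close>, which \<open>hi i\<close> then cancels.\<close>
  have "h i \<otimes> hz i (j - 1 + k) = h i \<otimes> (hz i (j - 1) \<otimes> hz i k)"
    using hz_Suc[OF i, of "j - 1 + k"] hz_Suc[OF i, of "j - 1"] step2 i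
    by (simp add: algebra_simps m_assoc del: atLeastAtMost_iff)
  then have "hi i \<otimes> h i \<otimes> hz i (j - 1 + k) = hi i \<otimes> h i \<otimes> (hz i (j - 1) \<otimes> hz i k)"
    using i by (simp add: m_assoc del: atLeastAtMost_iff)
  then show ?case
    using i by (simp add: hi_h del: atLeastAtMost_iff)
qed

lemma hz_minus:
  "i \<in> {1..n} \<Longrightarrow> hz i j \<otimes> hz i (- j) = \<one>" "i \<in> {1..n} \<Longrightarrow> hz i (- j) \<otimes> hz i j = \<one>"
  by (simp_all flip: hz_add)

lemma scaled_hz_pow:
  assumes i: "i \<in> {1..n}"
  shows "(s c \<otimes> hz i j) [^] (m::nat) = s (c ^ m) \<otimes> hz i (int m * j)"
proof (induction m)
  case (Suc m)
  have "(s c \<otimes> hz i j) [^] Suc m = s (c ^ m * c) \<otimes> hz i (int m * j + j)"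
    using i by (simp add: Suc s_mult_mult hz_add del: atLeastAtMost_iff)
  then show ?case by (simp add: algebra_simps)
qed simp

lemma laurent_superset:
  assumes "i \<in> {1..n}" "finite F" "Poly_Mapping.keys p \<subseteq> F"
  shows "laurent p i = (\<Oplus>j\<in>F. s (Poly_Mapping.lookup p j) \<otimes> hz i j)"
  unfolding laurent_def using assms
  by (intro add.finprod_mono_neutral_cong_left) (auto simp: in_keys_iff)

lemma laurent_closed [simp]: "i \<in> {1..n} \<Longrightarrow> laurent p i \<in> carrier R"
  unfolding laurent_def by (intro finsum_closed) auto

lemma laurent_zero [simp]: "laurent 0 i = \<zero>"
  by (simp add: laurent_def)

lemma laurent_single: "i \<in> {1..n} \<Longrightarrow> laurent (Poly_Mapping.single j c) i = s c \<otimes> hz i j"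
  by (subst laurent_superset[of i "{j}"]) (auto split: if_splits)

lemma laurent_one: "i \<in> {1..n} \<Longrightarrow> laurent 1 i = \<one>"
  using laurent_single[of i 0 1] by simp

lemma laurent_add:
  assumes i: "i \<in> {1..n}"
  shows "laurent (p + p') i = laurent p i \<oplus> laurent p' i"
proof -
  let ?F = "Poly_Mapping.keys p \<union> Poly_Mapping.keys p'"
  have "laurent (p + p') i = (\<Oplus>j\<in>?F. s (Poly_Mapping.lookup (p + p') j) \<otimes> hz i j)"
    using keys_add[of p p'] by (intro laurent_superset[OF i]) auto
  also have "\<dots> = (\<Oplus>j\<in>?F. s (Poly_Mapping.lookup p j) \<otimes> hz i j \<oplus> s (Poly_Mapping.lookup p' j) \<otimes> hz i j)"
    using i by (intro finsum_cong') (auto simp: lookup_add s_add l_distr)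
  also have "\<dots> = (\<Oplus>j\<in>?F. s (Poly_Mapping.lookup p j) \<otimes> hz i j) \<oplus> (\<Oplus>j\<in>?F. s (Poly_Mapping.lookup p' j) \<otimes> hz i j)"
    using i by (intro finsum_addf) auto
  also have "\<dots> = laurent p i \<oplus> laurent p' i"
    using laurent_superset[OF i, of ?F p] laurent_superset[OF i, of ?F p'] by simp
  finally show ?thesis .
qed

lemma laurent_minus:
  assumes i: "i \<in> {1..n}"
  shows "laurent (p - p') i = laurent p i \<ominus> laurent p' i"
proof -
  have "laurent p i = laurent (p - p') i \<oplus> laurent p' i"
    using laurent_add[OF i, of "p - p'" p'] by simp
  then show ?thesis
    using i by (simp add: minus_eq a_assoc r_neg del: atLeastAtMost_iff)
qed

lemma laurent_mult:
  assumes i: "i \<in> {1..n}"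
  shows "laurent (p * p') i = laurent p i \<otimes> laurent p' i"
proof (induction p rule: poly_mapping_induct)
  case (add p k v)
  have "laurent (Poly_Mapping.single k v * p') i = laurent (Poly_Mapping.single k v) i \<otimes> laurent p' i"
  proof (induction p' rule: poly_mapping_induct)
    case (add p' j u)
    then show ?case
      using i by (simp add: distrib_left laurent_add laurent_single mult_single r_distr s_mult_mult hz_add del: atLeastAtMost_iff)
  qed (use i in \<open>simp del: atLeastAtMost_iff\<close>)
  with add show ?case
    using i by (simp add: distrib_right laurent_add l_distr del: atLeastAtMost_iff)
qed (use i in \<open>simp del: atLeastAtMost_iff\<close>)

lemma laurent_apoly:
  "i \<in> {1..n} \<Longrightarrow> laurent (apoly d c j) i = (s c \<otimes> hz i j) [^] d \<ominus> \<one>"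
  by (simp add: apoly_def laurent_minus laurent_single laurent_one scaled_hz_pow)

lemma qcomm_hz:
  assumes "i \<in> {1..n}" "c \<noteq> 0" "qcomm c a (h i)"
  shows "qcomm (c powi j) a (hz i j)"
  using qcomm_pow_right[OF assms(3), of "nat j"]
    qcomm_pow_right[OF qcomm_inv_right[OF assms(3,2) hi_closed[OF assms(1)] h_hi[OF assms(1)] hi_h[OF assms(1)]], of "nat (- j)"]
  by (auto simp: hz_def power_int_def)

text \<open>Passing \<open>a\<close> multiplies h^k by c^k, which amounts to substituting c h for h.
  This is the source of the rescaling in the product of the image of y with the image of x.\<close>

lemma twist_laurent:
  assumes i: "i \<in> {1..n}" and c: "c \<noteq> 0" and a: "qcomm c a (h i)"
  shows "a \<otimes> laurent p i = laurent (subst_scale c p) i \<otimes> a"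
proof (induction p rule: poly_mapping_induct)
  case zero
  then show ?case using qcomm_closed[OF a] by (simp add: subst_scale_simps)
next
  case (add p k v)
  have "a \<otimes> (s v \<otimes> hz i k) = s (c powi k * v) \<otimes> hz i k \<otimes> a"
    using qcommD[OF qcomm_hz[OF i c a, of k]] qcomm_closed[OF a] i
    by (simp add: s_central_assoc[of a] s_mult_mult s_mult m_assoc s_central_assoc[of "s v"] del: atLeastAtMost_iff)
  with add show ?case
    using qcomm_closed[OF a] i
    by (simp add: subst_scale_simps laurent_add laurent_single l_distr r_distr del: atLeastAtMost_iff)
qed

lemma qcomm_laurent:
  assumes "i \<in> {1..n}" "qcomm 1 a (h i)"
  shows "qcomm 1 a (laurent p i)"
  using twist_laurent[OF assms(1) _ assms(2), of p] assms qcomm_closed[OF assms(2)]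
  by (simp add: qcomm_one_iff del: atLeastAtMost_iff)

text \<open>Only the factor with index \<open>k\<close> fails to commute with \<open>a\<close>, and
  it contributes \<open>c\<close> to the power of its exponent.\<close>

lemma qcomm_hzmono:
  assumes k: "k \<in> {1..n}" and c: "c \<noteq> 0" and a: "qcomm c a (h k)"
    and other: "\<And>j. j \<in> {1..n} \<Longrightarrow> j \<noteq> k \<Longrightarrow> qcomm 1 a (h j)"
  shows "qcomm (c powi e k) a (hzmono e)"
proof -
  \<comment> \<open>Generalised to sublists of the index range; distinctness ensures that the factor
    of index \<open>k\<close> is met at most once.\<close>
  have "qcomm (if k \<in> set js then c powi e k else 1) a (foldr (\<lambda>j acc. hz j (e j) \<otimes> acc) js \<one>)"
    if "set js \<subseteq> {1..n}" "distinct js" for js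
    using that
  proof (induction js)
    case Nil
    then show ?case using qcomm_closed[OF a] by simp
  next
    case (Cons j js)
    then have "qcomm (if j = k then c powi e k else 1) a (hz j (e j))"
      using qcomm_hz[OF k c a, of "e k"] qcomm_hz[of j 1 a "e j"] other[of j] by auto
    from qcomm_mult_right[OF this Cons.IH] Cons.prems show ?case
      by (cases "j = k") auto
  qed
  from this[of "[1..<n+1]"] k show ?thesis
    by (simp add: hzmono_def atLeastLessThanSuc_atLeastAtMost del: upt_Suc)
qed

lemma qcomm_hzmono_one:
  assumes "1 \<le> n" "\<And>j. j \<in> {1..n} \<Longrightarrow> qcomm 1 a (h j)"
  shows "qcomm 1 a (hzmono e)"
  using qcomm_hzmono[of 1 1 a e] assms by simp

lemma qcomm_h_h: "i \<in> {1..n} \<Longrightarrow> j \<in> {1..n} \<Longrightarrow> qcomm 1 (h i) (h j)"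
  using gen_commute[of "Gh i" "Gh j"] by (cases "i = j") (auto simp: qcomm_one_iff)

lemma hzmono_closed [simp]: "hzmono e \<in> carrier R"
proof -
  have "foldr (\<lambda>j acc. hz j (e j) \<otimes> acc) js \<one> \<in> carrier R" if "set js \<subseteq> {1..n}" for js
    using that by (induction js) auto
  from this[of "[1..<n+1]"] show ?thesis
    by (simp add: hzmono_def atLeastLessThanSuc_atLeastAtMost del: upt_Suc)
qed

lemma qcomm_hz_hz: "i \<in> {1..n} \<Longrightarrow> j \<in> {1..n} \<Longrightarrow> qcomm 1 (hz i e) (hz j e')"
  using qcomm_hz[of j 1 "hz i e" e'] qcomm_hz[of i 1 "h j" e] qcomm_h_h[of j i] qcomm_one_sym by simp

lemma qcomm_hzmono_h: "i \<in> {1..n} \<Longrightarrow> qcomm 1 (hzmono e) (h i)"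
  by (rule qcomm_one_sym, rule qcomm_hzmono_one) (auto intro: qcomm_h_h)

lemma qcomm_laurent_h: "i \<in> {1..n} \<Longrightarrow> j \<in> {1..n} \<Longrightarrow> qcomm 1 (laurent p i) (h j)"
  by (rule qcomm_one_sym, rule qcomm_laurent) (auto intro: qcomm_h_h)

text \<open>Both products run through the indices in the same order, so inverse factors are not
  adjacent: each power has to be moved past the rest of the first product, hence the auxiliary fact
  \<open>comm\<close>.\<close>

lemma hzmono_minus: "hzmono e \<otimes> hzmono (\<lambda>j. - e j) = \<one>"
proof -
  let ?m = "\<lambda>e js. foldr (\<lambda>j acc. hz j (e j) \<otimes> acc) js \<one>"
  have cl: "?m e js \<in> carrier R" if "set js \<subseteq> {1..n}" for js e
    using that by (induction js) auto
  have comm: "qcomm 1 (hz i k) (?m e js)" if "set js \<subseteq> {1..n}" "i \<in> {1..n}" for js e i k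
    using that
  proof (induction js)
    case (Cons j js)
    then show ?case
      using qcomm_mult_right[OF qcomm_hz_hz[of i j k "e j"]] by fastforce
  qed simp
  have "?m e js \<otimes> ?m (\<lambda>j. - e j) js = \<one>" if "set js \<subseteq> {1..n}" for js
    using that
  proof (induction js)
    case (Cons j js)
    let ?M = "?m e js" and ?M' = "?m (\<lambda>j. - e j) js"
    have j: "j \<in> {1..n}" and js: "set js \<subseteq> {1..n}" using Cons.prems by auto
    note c = cl[OF js] hz_closed[OF j]
    have "?m e (j # js) \<otimes> ?m (\<lambda>j. - e j) (j # js) = hz j (e j) \<otimes> (?M \<otimes> hz j (- e j)) \<otimes> ?M'"
      using c by (simp add: m_assoc)
    also have "?M \<otimes> hz j (- e j) = hz j (- e j) \<otimes> ?M"
      using comm[OF js j] by (simp add: qcomm_one_iff)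
    also have "hz j (e j) \<otimes> (hz j (- e j) \<otimes> ?M) \<otimes> ?M' = hz j (e j) \<otimes> hz j (- e j) \<otimes> (?M \<otimes> ?M')"
      using c by (simp add: m_assoc)
    finally show ?case
      using Cons.IH[OF js] hz_minus(1)[OF j] by simp
  qed simp
  from this[of "[1..<n+1]"] show ?thesis
    by (simp add: hzmono_def atLeastLessThanSuc_atLeastAtMost del: upt_Suc)
qed

section \<open>The shapes of the images of x and y, their commutation and their products\<close>

lemma qcomm_gen_h:
  assumes "g \<in> Agens n" "j \<in> {1..n}" "j \<noteq> gidx g"
  shows "qcomm 1 (\<xi> g) (h j)"
  using gen_commute[of g "Gh j"] gen_closed[of g] assms by (simp add: qcomm_one_iff)

text \<open>\<open>xform\<close> is the prescribed shape of the image of an x and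
  \<open>yform\<close> that of a y; \<open>g\<close> is whichever of the generators x, y of the
  target is selected by \<tau>.\<close>

definition xform :: "gen \<Rightarrow> (int \<Rightarrow>\<^sub>0 'k) \<Rightarrow> 'k \<Rightarrow> (nat \<Rightarrow> int) \<Rightarrow> 'a" where
  "xform g p b t = laurent p (gidx g) \<otimes> s b \<otimes> hzmono t \<otimes> \<xi> g"

definition yform :: "gen \<Rightarrow> (int \<Rightarrow>\<^sub>0 'k) \<Rightarrow> 'k \<Rightarrow> (nat \<Rightarrow> int) \<Rightarrow> 'a" where
  "yform g p b t = \<xi> g \<otimes> laurent p (gidx g) \<otimes> s b \<otimes> hzmono t"

lemma gidx_Agens: "g \<in> Agens n \<Longrightarrow> gidx g \<in> {1..n}"
  by (simp add: Agens_def)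

lemma xform_closed [simp]: "g \<in> Agens n \<Longrightarrow> xform g p b t \<in> carrier R"
  using gidx_Agens[of g] gen_closed[of g] by (simp add: xform_def del: atLeastAtMost_iff)

text \<open>Moving the generator to the right end rescales the polynomial and changes the scalar but
  keeps the monomial in the h. Commutation therefore only has to be studied for
  \<open>xform\<close>.\<close>

lemma yform_eq_xform:
  assumes g: "g \<in> Agens n" and c: "c \<noteq> 0" and gh: "qcomm c (\<xi> g) (h (gidx g))"
  shows "yform g p b t = xform g (subst_scale c p) (b * c powi t (gidx g)) t"
proof -
  note k = gidx_Agens[OF g]
  let ?L = "laurent (subst_scale c p) (gidx g)" and ?T = "hzmono t" and ?e = "c powi t (gidx g)"
  have T: "\<xi> g \<otimes> ?T = s ?e \<otimes> (?T \<otimes> \<xi> g)"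
    by (rule qcommD, rule qcomm_hzmono[OF k c gh]) (rule qcomm_gen_h[OF g])
  have cl: "\<xi> g \<in> carrier R" "?L \<in> carrier R" "?T \<in> carrier R"
    using gen_closed[OF g] laurent_closed[OF k] by simp_all
  have "yform g p b t = ?L \<otimes> \<xi> g \<otimes> s b \<otimes> ?T"
    by (simp add: yform_def twist_laurent[OF k c gh])
  also have "\<dots> = ?L \<otimes> (s b \<otimes> (\<xi> g \<otimes> ?T))"
    using cl by (simp add: m_assoc s_central_assoc[of "\<xi> g"])
  also have "\<dots> = xform g (subst_scale c p) (b * ?e) t"
    using cl by (simp add: T xform_def s_mult m_assoc)
  finally show ?thesis .
qed

text \<open>Exactly two crossings produce a scalar: \<open>g\<close> past the monomial with
  exponents \<open>t'\<close>, and the monomial with exponents \<open>t\<close> past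
  \<open>g'\<close>. All other pairs of factors commute because the indices differ.\<close>

lemma qcomm_xform_xform:
  assumes g: "g \<in> Agens n" and g': "g' \<in> Agens n" and ne: "gidx g \<noteq> gidx g'"
    and c: "c \<noteq> 0" "qcomm c (\<xi> g) (h (gidx g))" and c': "c' \<noteq> 0" "qcomm c' (\<xi> g') (h (gidx g'))"
  shows "qcomm (c powi t' (gidx g) * inverse (c' powi t (gidx g'))) (xform g p b t) (xform g' p' b' t')"
proof -
  let ?k = "gidx g" and ?l = "gidx g'"
  note k = gidx_Agens[OF g] and l = gidx_Agens[OF g']
  have n: "1 \<le> n" using k by simp
  note gk = qcomm_gen_h[OF g] and gl = qcomm_gen_h[OF g']
  let ?L = "laurent p ?k" and ?L' = "laurent p' ?l" and ?T = "hzmono t" and ?T' = "hzmono t'"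
  have cl [simp]: "?L \<in> carrier R" "?L' \<in> carrier R" "\<xi> g \<in> carrier R" "\<xi> g' \<in> carrier R"
    using k l g g' gen_closed by (simp_all del: atLeastAtMost_iff)
  have L: "qcomm 1 a ?L'" if "qcomm 1 a (h ?l)" for a
    by (rule qcomm_laurent[OF l that])
  have Z': "qcomm 1 ?L (\<xi> g')"
    by (rule qcomm_one_sym[OF qcomm_laurent[OF k gl[OF k ne]]])
  have "qcomm 1 ?L (xform g' p' b' t')"
    unfolding xform_def
    by (rule qcomm_mult4_right[OF L[OF qcomm_laurent_h[OF k l]] qcomm_scalar(2)
          qcomm_hzmono_one[OF n qcomm_laurent_h[OF k]] Z']) simp_all
  moreover have "qcomm 1 (s b) (xform g' p' b' t')"
    using g' by simp
  moreover have "qcomm (inverse (c' powi t ?l)) ?T (\<xi> g')"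
    using qcomm_sym[OF qcomm_hzmono[OF l c' gl]] c'(1) by simp
  then have "qcomm (inverse (c' powi t ?l)) ?T (xform g' p' b' t')"
    unfolding xform_def
    by (intro qcomm_mult4_right[OF L[OF qcomm_hzmono_h[OF l]] qcomm_scalar(2)
          qcomm_hzmono_one[OF n qcomm_hzmono_h]]) simp_all
  moreover have "qcomm 1 (\<xi> g) (\<xi> g')"
    using gen_commute[OF g g' ne] by (simp add: qcomm_one_iff)
  then have "qcomm (c powi t' ?k) (\<xi> g) (xform g' p' b' t')"
    unfolding xform_def
    by (rule qcomm_mult4_right[OF L[OF gk[OF l]] qcomm_scalar(2) qcomm_hzmono[OF k c gk], rotated -2])
      (use ne in simp_all)
  ultimately show ?thesis
    unfolding xform_def[of g] by (rule qcomm_mult4_left) simp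
qed

lemma qcomm_xform_hz:
  assumes g: "g \<in> Agens n" and l: "l \<in> {1..n}" and c: "c \<noteq> 0" "qcomm c (\<xi> g) (h l)"
  shows "qcomm (c powi m) (xform g p b t) (s \<gamma> \<otimes> hz l m)"
proof -
  note k = gidx_Agens[OF g]
  have 1: "qcomm 1 a (s \<gamma> \<otimes> hz l m)" if "qcomm 1 a (h l)" for a
    using qcomm_mult_right[OF qcomm_scalar(2)[OF qcomm_closed(1)[OF that]] qcomm_hz[OF l _ that, of m]] by simp
  have "qcomm 1 (laurent p (gidx g)) (s \<gamma> \<otimes> hz l m)"
    by (rule 1[OF qcomm_laurent_h[OF k l]])
  moreover have "qcomm 1 (s b) (s \<gamma> \<otimes> hz l m)"
    using l by (simp del: atLeastAtMost_iff)
  moreover have "qcomm 1 (hzmono t) (s \<gamma> \<otimes> hz l m)"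
    by (rule 1[OF qcomm_hzmono_h[OF l]])
  moreover have "qcomm (c powi m) (\<xi> g) (s \<gamma> \<otimes> hz l m)"
    using qcomm_mult_right[OF qcomm_scalar(2)[OF qcomm_closed(1)[OF c(2)]] qcomm_hz[OF l c, of m]] by simp
  ultimately show ?thesis
    unfolding xform_def by (rule qcomm_mult4_left) simp
qed

text \<open>The two generators meet in the middle and become a polynomial in h, which commutes with
  everything between the scalars and the monomials; these then cancel against their
  inverses.\<close>

lemma xform_yform:
  assumes g: "g \<in> Agens n" and g': "g' \<in> Agens n" and eq: "gidx g' = gidx g" and b: "b \<noteq> 0"
    and gg': "\<xi> g \<otimes> \<xi> g' = laurent a (gidx g)"
  shows "xform g p b t \<otimes> yform g' p' (inverse b) (\<lambda>j. - t j) = laurent (p * p' * a) (gidx g)"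
proof -
  note k = gidx_Agens[OF g]
  let ?L = "laurent p (gidx g)" and ?L' = "laurent p' (gidx g)" and ?W = "laurent a (gidx g)"
  let ?T = "hzmono t" and ?T' = "hzmono (\<lambda>j. - t j)"
  have cl: "?L \<in> carrier R" "?L' \<in> carrier R" "?W \<in> carrier R" "\<xi> g \<in> carrier R" "\<xi> g' \<in> carrier R"
    using k g g' gen_closed by (simp_all del: atLeastAtMost_iff)
  have T: "?T \<otimes> ?W = ?W \<otimes> ?T" "?T \<otimes> ?L' = ?L' \<otimes> ?T"
    using qcomm_laurent[OF k qcomm_hzmono_h[OF k]] by (simp_all add: qcomm_one_iff)
  have "xform g p b t \<otimes> yform g' p' (inverse b) (\<lambda>j. - t j)
      = ?L \<otimes> s b \<otimes> ?T \<otimes> (\<xi> g \<otimes> \<xi> g') \<otimes> ?L' \<otimes> s (inverse b) \<otimes> ?T'"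
    using cl by (simp add: xform_def yform_def eq m_assoc)
  also have "\<dots> = ?L \<otimes> s b \<otimes> (?T \<otimes> ?W) \<otimes> ?L' \<otimes> s (inverse b) \<otimes> ?T'"
    using cl by (simp add: gg' m_assoc)
  also have "\<dots> = ?L \<otimes> s b \<otimes> ?W \<otimes> (?T \<otimes> ?L') \<otimes> s (inverse b) \<otimes> ?T'"
    unfolding T(1) using cl by (simp add: m_assoc)
  also have "\<dots> = ?L \<otimes> s b \<otimes> ?W \<otimes> ?L' \<otimes> (?T \<otimes> s (inverse b)) \<otimes> ?T'"
    unfolding T(2) using cl by (simp add: m_assoc)
  also have "?T \<otimes> s (inverse b) = s (inverse b) \<otimes> ?T"
    by (rule s_central[symmetric]) simp
  also have "?L \<otimes> s b \<otimes> ?W \<otimes> ?L' \<otimes> (s (inverse b) \<otimes> ?T) \<otimes> ?T'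
      = ?L \<otimes> (s b \<otimes> (?W \<otimes> ?L')) \<otimes> s (inverse b) \<otimes> (?T \<otimes> ?T')"
    using cl by (simp add: m_assoc)
  also have "s b \<otimes> (?W \<otimes> ?L') = ?W \<otimes> ?L' \<otimes> s b"
    using cl by (intro s_central) simp
  also have "?L \<otimes> (?W \<otimes> ?L' \<otimes> s b) \<otimes> s (inverse b) \<otimes> (?T \<otimes> ?T') = ?L \<otimes> (?W \<otimes> ?L') \<otimes> (s b \<otimes> s (inverse b)) \<otimes> (?T \<otimes> ?T')"
    using cl by (simp add: m_assoc)
  also have "\<dots> = laurent (p * (a * p')) (gidx g)"
    using cl b k by (simp add: hzmono_minus laurent_mult del: atLeastAtMost_iff)
  finally show ?thesis
    by (simp add: ac_simps)
qed

text \<open>Here the scalars and monomials meet and cancel first. The generators stay on the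
  outside, so \<open>g'\<close> has to cross both polynomials before it reaches \<open>g\<close>,
  and this rescales them by \<open>c\<close>.\<close>

lemma yform_xform:
  assumes g: "g \<in> Agens n" and g': "g' \<in> Agens n" and eq: "gidx g' = gidx g" and b: "b \<noteq> 0"
    and c: "c \<noteq> 0" "qcomm c (\<xi> g') (h (gidx g))"
    and gg': "\<xi> g' \<otimes> \<xi> g = laurent a (gidx g)"
  shows "yform g' p' (inverse b) (\<lambda>j. - t j) \<otimes> xform g p b t = laurent (subst_scale c (p * p') * a) (gidx g)"
proof -
  note k = gidx_Agens[OF g]
  let ?L = "laurent p (gidx g)" and ?L' = "laurent p' (gidx g)"
  let ?T = "hzmono t" and ?T' = "hzmono (\<lambda>j. - t j)"
  have cl: "?L \<in> carrier R" "?L' \<in> carrier R" "\<xi> g \<in> carrier R" "\<xi> g' \<in> carrier R"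
    using k g g' gen_closed by (simp_all del: atLeastAtMost_iff)
  have T: "?T' \<otimes> ?L = ?L \<otimes> ?T'"
    using qcomm_laurent[OF k qcomm_hzmono_h[OF k]] by (simp add: qcomm_one_iff)
  have TT: "?T' \<otimes> ?T = \<one>"
    using hzmono_minus[of "\<lambda>j. - t j"] by simp
  have "yform g' p' (inverse b) (\<lambda>j. - t j) \<otimes> xform g p b t
      = \<xi> g' \<otimes> ?L' \<otimes> s (inverse b) \<otimes> (?T' \<otimes> ?L) \<otimes> s b \<otimes> ?T \<otimes> \<xi> g"
    using cl by (simp add: xform_def yform_def eq m_assoc)
  also have "\<dots> = \<xi> g' \<otimes> ?L' \<otimes> (s (inverse b) \<otimes> ?L) \<otimes> (?T' \<otimes> s b) \<otimes> ?T \<otimes> \<xi> g"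
    unfolding T using cl by (simp add: m_assoc)
  also have "s (inverse b) \<otimes> ?L = ?L \<otimes> s (inverse b)"
    using cl by (intro s_central) simp
  also have "?T' \<otimes> s b = s b \<otimes> ?T'"
    by (rule s_central[symmetric]) simp
  also have "\<xi> g' \<otimes> ?L' \<otimes> (?L \<otimes> s (inverse b)) \<otimes> (s b \<otimes> ?T') \<otimes> ?T \<otimes> \<xi> g
      = \<xi> g' \<otimes> (?L' \<otimes> ?L) \<otimes> (s (inverse b) \<otimes> s b) \<otimes> (?T' \<otimes> ?T) \<otimes> \<xi> g"
    using cl by (simp add: m_assoc)
  also have "\<dots> = \<xi> g' \<otimes> laurent (p' * p) (gidx g) \<otimes> \<xi> g"
    using cl b k by (simp add: TT laurent_mult del: atLeastAtMost_iff)
  also have "\<dots> = laurent (subst_scale c (p' * p)) (gidx g) \<otimes> (\<xi> g' \<otimes> \<xi> g)"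
    using cl laurent_closed[OF k] by (simp add: twist_laurent[OF k c] m_assoc)
  finally show ?thesis
    using k by (simp add: gg' mult.commute[of p] del: atLeastAtMost_iff flip: laurent_mult)
qed

end

section \<open>Injectivity of Laurent evaluation\<close>

lemma (in weyl_relations) laurent_inject:
  assumes i: "i \<in> {1..n}"
    and \<psi>: "kalg_hom R s linops (\<lambda>c F e. c * F e) \<psi>" "\<And>g. g \<in> Agens n \<Longrightarrow> \<psi> (\<xi> g) = actop d q g"
    and eq: "laurent p i = laurent p' i"
  shows "p = p'"
proof -
  interpret H: ring_hom_ring R "linops :: (((nat \<Rightarrow> int) \<Rightarrow> 'k) \<Rightarrow> (nat \<Rightarrow> int) \<Rightarrow> 'k) ring" \<psi>
    using \<psi>(1) by (intro ring_hom_ringI2 ring_axioms linops_ring) (simp add: kalg_hom_def)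
  have hz: "\<psi> (hz i j) = shift i j" for j
    using i \<psi>(2)[of "Gh i"] \<psi>(2)[of "Ghi i"]
    by (cases "0 \<le> j") (simp_all only: hz_def if_True if_False H.hom_nat_pow h_closed hi_closed
        Agens_iff actop.simps shift_pow, simp_all)
  \<comment> \<open>The indicator of the hyperplane of exponent vectors with i-th entry 0. The power
    h_i^j moves it to the hyperplane with i-th entry j, so the value at a vector is the coefficient
    belonging to its i-th entry; a constant vector is later used to reach any prescribed
    entry.\<close>
  let ?\<delta> = "\<lambda>e :: nat \<Rightarrow> int. if e i = 0 then 1 else 0 :: 'k"
  have coeff: "\<psi> (laurent p i) ?\<delta> e = Poly_Mapping.lookup p (e i)" for p e
  proof (induction p rule: poly_mapping_induct)
    case zero
    then show ?case by (simp add: linops_simps)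
  next
    case (add p k v)
    have "\<psi> (s v \<otimes> hz i k) = (\<lambda>F e. v * shift i k F e)"
      using i \<psi>(1) hz by (simp add: kalg_hom_def linops_simps o_def del: atLeastAtMost_iff)
    with add show ?case
      using i by (auto simp: laurent_add laurent_single linops_simps shift_def lookup_add lookup_single
          simp del: atLeastAtMost_iff)
  qed
  have "Poly_Mapping.lookup p j = Poly_Mapping.lookup p' j" for j
    using coeff[of p "\<lambda>_. j"] coeff[of p' "\<lambda>_. j"] eq by simp
  then show ?thesis by (intro poly_mapping_eqI)
qed

lemma AA_laurent_inject:
  assumes "\<And>i. i \<in> {1..n} \<Longrightarrow> q i \<noteq> 0" "i \<in> {1..n}"
    and "weyl_relations.laurent (AA n d q) (sA n d q) (\<lambda>g. clA n d q (fgen g)) p i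
       = weyl_relations.laurent (AA n d q) (sA n d q) (\<lambda>g. clA n d q (fgen g)) p' i"
  shows "p = p'"
proof -
  interpret L: weyl_relations linops "\<lambda>c F e. c * F e" n d q "actop d q"
    using assms(1) by (rule linops_weyl_relations)
  interpret A: weyl_relations "AA n d q" "sA n d q" n d q "\<lambda>g. clA n d q (fgen g)"
    by (rule AA_weyl_relations)
  show ?thesis
    using L.AA_lift A.laurent_inject[OF assms(2) _ _ assms(3)] by metis
qed

section \<open>The proposed images satisfy the relations\<close>

context weyl_relations
begin

context
  fixes r :: nat and qt :: "nat \<Rightarrow> 'k" and w :: "nat \<Rightarrow> nat"
    and \<tau> m :: "nat \<Rightarrow> int" and b \<gamma> :: "nat \<Rightarrow> 'k" and t :: "nat \<Rightarrow> nat \<Rightarrow> int"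
    and p p' :: "nat \<Rightarrow> (int \<Rightarrow>\<^sub>0 'k)"
begin

definition zgen :: "nat \<Rightarrow> gen" where
  "zgen i = (if \<tau> i = 0 then Gx (w i) else Gy (w i))"

definition zgen' :: "nat \<Rightarrow> gen" where
  "zgen' i = (if \<tau> i = 0 then Gy (w i) else Gx (w i))"

text \<open>The scalar by which \<open>zgen i\<close> passes \<open>h (w i)\<close>; for
  \<open>zgen' i\<close> it is the inverse. With these three notions the two values of \<tau> can be
  treated together.\<close>

definition ratio :: "nat \<Rightarrow> 'k" where
  "ratio i = (if \<tau> i = 0 then q (w i) else inverse (q (w i)))"

text \<open>The theorem prescribes no image of h_i^-1; the value chosen is the inverse of the image
  of h_i.\<close>

definition image_gen :: "gen \<Rightarrow> 'a" where
  "image_gen g = (case g of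
      Gx i \<Rightarrow> xform (zgen i) (p i) (b i) (t i)
    | Gy i \<Rightarrow> yform (zgen' i) (p' i) (inverse (b i)) (\<lambda>j. - t i j)
    | Gh i \<Rightarrow> s (\<gamma> i) \<otimes> hz (w i) (m i)
    | Ghi i \<Rightarrow> s (inverse (\<gamma> i)) \<otimes> hz (w i) (- m i))"

text \<open>Injectivity of evaluation is an assumption because the relations alone do not imply it:
  they also hold in the zero ring. For \<open>AA n d q\<close> it comes from the lattice
  action.\<close>

lemma image_weyl_relations:
  assumes q0: "\<And>i. i \<in> {1..n} \<Longrightarrow> q i \<noteq> 0"
    and inj: "\<And>i f f'. i \<in> {1..n} \<Longrightarrow> laurent f i = laurent f' i \<Longrightarrow> f = f'"
    and w: "inj_on w {1..r}" "w ` {1..r} \<subseteq> {1..n}"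
    and \<tau>: "\<forall>i\<in>{1..r}. \<tau> i \<in> {0, 1}"
    and b\<gamma>: "\<forall>i\<in>{1..r}. b i \<noteq> 0 \<and> \<gamma> i \<noteq> 0"
    and c1: "\<forall>i\<in>{1..r}. q (w i) powi ((-1) ^ nat (\<tau> i) * m i) = qt i"
    and c2: "\<forall>i\<in>{1..r}. \<forall>l\<in>{1..r}.
              q (w i) powi (t l (w i) * (1 - \<tau> i)) * q (w i) powi (- t l (w i) * \<tau> i)
            * q (w l) powi (- t i (w l) * (1 - \<tau> l)) * q (w l) powi (t i (w l) * \<tau> l) = 1"
    and c3: "\<forall>i\<in>{1..r}.
              laurent (p i) (w i) \<otimes> laurent (p' i) (w i) \<otimes>
                ((s (q (w i) powi (1 - \<tau> i)) \<otimes> h (w i)) [^] d \<ominus> \<one>)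
            = (s (qt i) \<otimes> s (\<gamma> i) \<otimes> hz (w i) (m i)) [^] d \<ominus> \<one>"
  shows "weyl_relations R s r d qt image_gen"
proof -
  have wn: "w i \<in> {1..n}" if "i \<in> {1..r}" for i
    using w(2) that by blast
  have \<tau>01: "\<tau> i = 0 \<or> \<tau> i = 1" if "i \<in> {1..r}" for i
    using \<tau> that by blast
  have zA: "zgen i \<in> Agens n" "zgen' i \<in> Agens n" if "i \<in> {1..r}" for i
    using wn[OF that] by (simp_all add: zgen_def zgen'_def)
  have zi: "gidx (zgen i) = w i" "gidx (zgen' i) = w i" for i
    by (simp_all add: zgen_def zgen'_def)
  have ratio0: "ratio i \<noteq> 0" if "i \<in> {1..r}" for i
    using q0[OF wn[OF that]] by (simp add: ratio_def)
  have xh: "qcomm (q j) (\<xi> (Gx j)) (h j)" "qcomm (inverse (q j)) (\<xi> (Gy j)) (h j)" if "j \<in> {1..n}" for j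
    using that x_h[OF that] y_h[OF that] gen_closed[of "Gx j"] gen_closed[of "Gy j"]
    by (simp_all add: qcomm_def m_assoc)
  have zh: "qcomm (ratio i) (\<xi> (zgen i)) (h (w i))" "qcomm (inverse (ratio i)) (\<xi> (zgen' i)) (h (w i))"
    if "i \<in> {1..r}" for i
    using xh[OF wn[OF that]] by (simp_all add: ratio_def zgen_def zgen'_def)
  have zh_ne: "qcomm 1 (\<xi> (zgen i)) (h (w l))" "qcomm 1 (\<xi> (zgen' i)) (h (w l))"
    if "i \<in> {1..r}" "l \<in> {1..r}" "w i \<noteq> w l" for i l
    using that zA wn by (auto intro!: qcomm_gen_h simp: zi)
  \<comment> \<open>For either value of \<tau> the product in the opposite order is the same
    polynomial with h rescaled by the inverse of \<open>ratio i\<close>. This matches the rescaling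
    that \<open>yform_xform\<close> applies to \<open>p i * p' i\<close>, so one hypothesis settles
    both products.\<close>
  have zz': "\<xi> (zgen i) \<otimes> \<xi> (zgen' i) = laurent (apoly d (q (w i) powi (1 - \<tau> i)) 1) (w i)"
    and z'z: "\<xi> (zgen' i) \<otimes> \<xi> (zgen i)
      = laurent (subst_scale (inverse (ratio i)) (apoly d (q (w i) powi (1 - \<tau> i)) 1)) (w i)"
    if "i \<in> {1..r}" for i
    using \<tau>01[OF that] x_y[OF wn[OF that]] y_x[OF wn[OF that]] wn[OF that] q0[OF wn[OF that]]
    by (auto simp: zgen_def zgen'_def laurent_apoly subst_scale_apoly hz_1 ratio_def simp del: atLeastAtMost_iff)
  have ratio_m: "ratio i powi m i = qt i" if "i \<in> {1..r}" for i
    using \<tau>01[OF that] c1[rule_format, OF that] by (auto simp: ratio_def power_int_inverse power_int_minus)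
  \<comment> \<open>The identity in the ring is lifted to polynomials by \<open>inj\<close>, which
    makes it available for rescaling.\<close>
  have poly: "p i * p' i * apoly d (q (w i) powi (1 - \<tau> i)) 1 = apoly d (qt i * \<gamma> i) (m i)"
    if "i \<in> {1..r}" for i
    using c3[rule_format, OF that] wn[OF that]
    by (intro inj[of "w i"]) (simp_all add: laurent_mult laurent_apoly hz_1 s_mult del: atLeastAtMost_iff)
  \<comment> \<open>The condition \<open>c2\<close> with the exponents for the two values of \<tau>
    collected into powers of \<open>ratio\<close>.\<close>
  have ratio_t: "ratio i powi t l (w i) = ratio l powi t i (w l)" if "i \<in> {1..r}" "l \<in> {1..r}" for i l
    using \<tau>01[OF that(1)] \<tau>01[OF that(2)] c2[rule_format, OF that] q0[OF wn[OF that(1)]] q0[OF wn[OF that(2)]]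
    by (auto simp: ratio_def power_int_inverse power_int_minus field_simps)
  \<comment> \<open>The polynomial and scalar produced by \<open>yform_eq_xform\<close>. Their
    values are irrelevant for commutation, which is proved below for arbitrary ones.\<close>
  define yp yb where "yp i = subst_scale (inverse (ratio i)) (p' i)"
    and "yb i = inverse (b i) * inverse (ratio i) powi (- t i (w i))" for i
  have y_eq: "yform (zgen' i) (p' i) (inverse (b i)) (\<lambda>j. - t i j) = xform (zgen' i) (yp i) (yb i) (\<lambda>j. - t i j)"
    if "i \<in> {1..r}" for i
    using yform_eq_xform[OF zA(2)[OF that], of "inverse (ratio i)"] zh(2)[OF that] ratio0[OF that]
    by (simp add: zi yp_def yb_def)
  have XH: "qcomm 1 (image_gen g) (s c \<otimes> hz (w l) e)"
    if "i \<in> {1..r}" "l \<in> {1..r}" "i \<noteq> l" "g = Gx i \<or> g = Gy i" for i l c e g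
  proof -
    have ne: "w i \<noteq> w l"
      using w(1) that by (meson inj_onD)
    show ?thesis
      using qcomm_xform_hz[OF zA(1)[OF that(1)] wn[OF that(2)], of 1 e] zh_ne[OF that(1,2) ne]
        qcomm_xform_hz[OF zA(2)[OF that(1)] wn[OF that(2)], of 1 e] that(1,4)
      by (auto simp: image_gen_def y_eq simp del: atLeastAtMost_iff)
  qed
  have XX: "qcomm 1 (image_gen g) (image_gen g')"
    if "i \<in> {1..r}" "l \<in> {1..r}" "i \<noteq> l" "g = Gx i \<or> g = Gy i" "g' = Gx l \<or> g' = Gy l" for i l g g'
  proof -
    have ne: "w i \<noteq> w l"
      using w(1) that by (meson inj_onD)
    have *: "qcomm 1 (xform z f c u) (xform z' f' c' u')"
      if "z \<in> Agens n" "z' \<in> Agens n" "gidx z = w i" "gidx z' = w l"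
        "\<rho> \<noteq> 0" "qcomm \<rho> (\<xi> z) (h (w i))" "\<rho>' \<noteq> 0" "qcomm \<rho>' (\<xi> z') (h (w l))"
        "\<rho> powi u' (w i) = \<rho>' powi u (w l)" for z z' f f' c c' u u' \<rho> \<rho>'
      using qcomm_xform_xform[of z z' \<rho> \<rho>' u' u f c f' c'] that ne by simp
    note Z = zA(1)[OF that(1)] zA(2)[OF that(1)] zA(1)[OF that(2)] zA(2)[OF that(2)]
    note Q = zh(1)[OF that(1)] zh(2)[OF that(1)] zh(1)[OF that(2)] zh(2)[OF that(2)]
    have r0: "ratio i \<noteq> 0" "ratio l \<noteq> 0" "inverse (ratio i) \<noteq> 0" "inverse (ratio l) \<noteq> 0"
      using ratio0 that by simp_all
    note T = ratio_t[OF that(1,2)]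
    \<comment> \<open>Replacing \<open>zgen\<close> by \<open>zgen'\<close> inverts its ratio and
      negates its exponents, so in each of the four cases the required equation is \<open>T\<close>
      or its inverse.\<close>
    have "qcomm 1 (xform (zgen i) f c (t i)) (xform (zgen l) f' c' (t l))" for f c f' c'
      by (rule *[OF Z(1) Z(3) zi(1) zi(1) r0(1) Q(1) r0(2) Q(3)]) (rule T)
    moreover have "qcomm 1 (xform (zgen i) f c (t i)) (xform (zgen' l) f' c' (\<lambda>j. - t l j))" for f c f' c'
      by (rule *[OF Z(1) Z(4) zi(1) zi(2) r0(1) Q(1) r0(4) Q(4)]) (simp add: T power_int_minus power_int_inverse)
    moreover have "qcomm 1 (xform (zgen' i) f c (\<lambda>j. - t i j)) (xform (zgen l) f' c' (t l))" for f c f' c'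
      by (rule *[OF Z(2) Z(3) zi(2) zi(1) r0(3) Q(2) r0(2) Q(3)]) (simp add: T power_int_minus power_int_inverse)
    moreover have "qcomm 1 (xform (zgen' i) f c (\<lambda>j. - t i j)) (xform (zgen' l) f' c' (\<lambda>j. - t l j))" for f c f' c'
      by (rule *[OF Z(2) Z(4) zi(2) zi(2) r0(3) Q(2) r0(4) Q(4)]) (simp add: T power_int_minus power_int_inverse)
    ultimately show ?thesis
      using that by (auto simp: image_gen_def y_eq simp del: atLeastAtMost_iff)
  qed
  have HH: "qcomm 1 (s c \<otimes> hz (w i) e) (s c' \<otimes> hz (w l) e')" if "i \<in> {1..r}" "l \<in> {1..r}" for i l c e c' e'
  proof -
    have "(s c \<otimes> hz (w i) e) \<otimes> (s c' \<otimes> hz (w l) e') = (s c' \<otimes> hz (w l) e') \<otimes> (s c \<otimes> hz (w i) e)"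
      using wn[OF that(1)] wn[OF that(2)] qcomm_hz_hz[of "w i" "w l" e e']
      by (simp add: s_mult_mult qcomm_one_iff mult.commute del: atLeastAtMost_iff)
    then show ?thesis
      using wn[OF that(1)] wn[OF that(2)] by (simp add: qcomm_one_iff del: atLeastAtMost_iff)
  qed
  have closed: "image_gen g \<in> carrier R" if "g \<in> Agens r" for g
    using that wn zA by (cases g) (auto simp: image_gen_def y_eq simp del: atLeastAtMost_iff)
  show ?thesis
  proof unfold_locales
    show "image_gen g \<in> carrier R" if "g \<in> Agens r" for g by (rule closed[OF that])
    fix i assume i: "i \<in> {1..r}"
    note wi = wn[OF i]
    have \<gamma>: "\<gamma> i \<noteq> 0" and b: "b i \<noteq> 0" using b\<gamma> i by auto
    have cl: "image_gen (Gx i) \<in> carrier R" "image_gen (Gy i) \<in> carrier R" "image_gen (Gh i) \<in> carrier R"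
      using closed i by simp_all
    show "image_gen (Gh i) \<otimes> image_gen (Ghi i) = \<one>" "image_gen (Ghi i) \<otimes> image_gen (Gh i) = \<one>"
      using wi \<gamma> by (simp_all add: image_gen_def s_mult_mult hz_minus del: atLeastAtMost_iff)
    have "qcomm (qt i) (image_gen (Gx i)) (image_gen (Gh i))"
      using qcomm_xform_hz[OF zA(1)[OF i] wi ratio0[OF i] zh(1)[OF i], of "m i"]
      by (simp add: image_gen_def ratio_m[OF i])
    then show "image_gen (Gx i) \<otimes> image_gen (Gh i) = s (qt i) \<otimes> image_gen (Gh i) \<otimes> image_gen (Gx i)"
      using cl by (simp add: qcomm_def m_assoc)
    have "qcomm (inverse (qt i)) (image_gen (Gy i)) (image_gen (Gh i))"
      using qcomm_xform_hz[OF zA(2)[OF i] wi _ zh(2)[OF i], of "m i"] ratio0[OF i]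
      by (simp add: image_gen_def y_eq[OF i] power_int_inverse ratio_m[OF i])
    then show "image_gen (Gy i) \<otimes> image_gen (Gh i) = s (inverse (qt i)) \<otimes> image_gen (Gh i) \<otimes> image_gen (Gy i)"
      using cl by (simp add: qcomm_def m_assoc)
    have "image_gen (Gx i) \<otimes> image_gen (Gy i) = laurent (apoly d (qt i * \<gamma> i) (m i)) (w i)"
      using xform_yform[OF zA(1)[OF i] zA(2)[OF i] _ b, of "apoly d (q (w i) powi (1 - \<tau> i)) 1" "p i" "t i" "p' i"] zz'[OF i] poly[OF i]
      by (simp add: image_gen_def zi)
    then show "image_gen (Gx i) \<otimes> image_gen (Gy i) = (s (qt i) \<otimes> image_gen (Gh i)) [^] d \<ominus> \<one>"
      using wi by (simp add: laurent_apoly image_gen_def s_mult m_assoc del: atLeastAtMost_iff)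
    let ?a = "apoly d (q (w i) powi (1 - \<tau> i)) 1" and ?\<rho> = "inverse (ratio i)"
    have \<rho>: "?\<rho> \<noteq> 0" using ratio0[OF i] by simp
    have "image_gen (Gy i) \<otimes> image_gen (Gx i)
        = laurent (subst_scale ?\<rho> (p i * p' i) * subst_scale ?\<rho> ?a) (w i)"
      using yform_xform[OF zA(1)[OF i] zA(2)[OF i] _ b \<rho>, of "subst_scale ?\<rho> ?a" "p' i" "t i" "p i"] z'z[OF i] zh(2)[OF i]
      by (simp add: image_gen_def zi)
    also have "subst_scale ?\<rho> (p i * p' i) * subst_scale ?\<rho> ?a = subst_scale ?\<rho> (apoly d (qt i * \<gamma> i) (m i))"
      by (simp add: poly[OF i] flip: subst_scale_mult[OF \<rho>])
    also have "\<dots> = apoly d (\<gamma> i) (m i)"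
    proof -
      \<comment> \<open>Rescaling h by \<open>?\<rho>\<close> multiplies h^m by the inverse of
        \<open>qt i\<close>, by \<open>ratio_m\<close>, and so removes exactly the factor by which
        the two defining relations of the source differ.\<close>
      have "?\<rho> powi m i * (qt i * \<gamma> i) = \<gamma> i"
        using ratio0[OF i] by (simp add: power_int_inverse flip: ratio_m[OF i])
      then show ?thesis by (simp only: subst_scale_apoly)
    qed
    finally show "image_gen (Gy i) \<otimes> image_gen (Gx i) = image_gen (Gh i) [^] d \<ominus> \<one>"
      using wi by (simp add: laurent_apoly image_gen_def del: atLeastAtMost_iff)
  next
    fix g g' assume g: "g \<in> Agens r" "g' \<in> Agens r" and ne: "gidx g \<noteq> gidx g'"
    \<comment> \<open>The images of h and of its inverse are both scalar multiples of a power of h,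
      which merges their cases.\<close>
    have Hform: "\<exists>c e. image_gen g = s c \<otimes> hz (w (gidx g)) e"
      if "\<not> (g = Gx (gidx g) \<or> g = Gy (gidx g))" for g
      using that by (cases g) (auto simp: image_gen_def)
    have i: "gidx g \<in> {1..r}" "gidx g' \<in> {1..r}"
      using g by (auto simp: Agens_def)
    have "qcomm 1 (image_gen g) (image_gen g')"
    proof (cases "g = Gx (gidx g) \<or> g = Gy (gidx g)")
      case True
      then show ?thesis
        using XX[OF i ne] XH[OF i ne] Hform[of g'] by metis
    next
      case False
      then show ?thesis
        using qcomm_one_sym[OF XH[OF i(2,1) ne[symmetric]]] HH[OF i] Hform[of g] Hform[of g'] by metis
    qed
    then show "image_gen g \<otimes> image_gen g' = image_gen g' \<otimes> image_gen g"
      by (simp add: qcomm_one_iff)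
  qed
qed

end

end

section \<open>Existence and uniqueness of the homomorphism\<close>

theorem theorem3p1:
  fixes n r d :: nat and q qt :: "nat \<Rightarrow> 'k::field" and w :: "nat \<Rightarrow> nat"
    and \<tau> m :: "nat \<Rightarrow> int" and b \<gamma> :: "nat \<Rightarrow> 'k" and t :: "nat \<Rightarrow> nat \<Rightarrow> int"
    and p p' :: "nat \<Rightarrow> (int \<Rightarrow>\<^sub>0 'k)"
  assumes d: "1 \<le> d"
    and rn: "0 < r" "r \<le> n"
    and q: "\<forall>i\<in>{1..n}. q i \<noteq> 0 \<and> q i ^ d \<noteq> 1"
    and qt: "\<forall>i\<in>{1..r}. qt i \<noteq> 0 \<and> qt i ^ d \<noteq> 1"
    and w: "inj_on w {1..r}" "w ` {1..r} \<subseteq> {1..n}"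
    and \<tau>: "\<forall>i\<in>{1..r}. \<tau> i \<in> {0, 1}"
    and m: "\<forall>i\<in>{1..r}. m i \<noteq> 0"
    and b\<gamma>: "\<forall>i\<in>{1..r}. b i \<noteq> 0 \<and> \<gamma> i \<noteq> 0"
    and c1: "\<forall>i\<in>{1..r}. q (w i) powi ((-1) ^ nat (\<tau> i) * m i) = qt i"
    and c2: "\<forall>i\<in>{1..r}. \<forall>l\<in>{1..r}.
              q (w i) powi (t l (w i) * (1 - \<tau> i)) * q (w i) powi (- t l (w i) * \<tau> i)
            * q (w l) powi (- t i (w l) * (1 - \<tau> l)) * q (w l) powi (t i (w l) * \<tau> l) = 1"
    and c3: "\<forall>i\<in>{1..r}.
              lev n d q (p i) (w i) \<otimes>\<^bsub>AA n d q\<^esub> lev n d q (p' i) (w i) \<otimes>\<^bsub>AA n d q\<^esub>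
                ((sA n d q (q (w i) powi (1 - \<tau> i)) \<otimes>\<^bsub>AA n d q\<^esub> hA n d q (w i)) [^]\<^bsub>AA n d q\<^esub> d
                  \<ominus>\<^bsub>AA n d q\<^esub> \<one>\<^bsub>AA n d q\<^esub>)
            = (sA n d q (qt i) \<otimes>\<^bsub>AA n d q\<^esub> sA n d q (\<gamma> i) \<otimes>\<^bsub>AA n d q\<^esub> hpow n d q (w i) (m i))
                [^]\<^bsub>AA n d q\<^esub> d \<ominus>\<^bsub>AA n d q\<^esub> \<one>\<^bsub>AA n d q\<^esub>"
    and c4: "\<forall>i\<in>{1..r}. \<gamma> i ^ d = qt i powi (- \<tau> i * int d)"
  shows "\<exists>\<psi>. (kalg_hom (AA r d qt) (sA r d qt) (AA n d q) (sA n d q) \<psi> \<and>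
             (\<forall>i\<in>{1..r}.
                \<psi> (hA r d qt i) = sA n d q (\<gamma> i) \<otimes>\<^bsub>AA n d q\<^esub> hpow n d q (w i) (m i) \<and>
                \<psi> (xA r d qt i) = lev n d q (p i) (w i) \<otimes>\<^bsub>AA n d q\<^esub> sA n d q (b i)
                   \<otimes>\<^bsub>AA n d q\<^esub> hmono n d q (t i)
                   \<otimes>\<^bsub>AA n d q\<^esub> (if \<tau> i = 0 then xA n d q (w i) else yA n d q (w i)) \<and>
                \<psi> (yA r d qt i) = (if \<tau> i = 0 then yA n d q (w i) else xA n d q (w i))
                   \<otimes>\<^bsub>AA n d q\<^esub> lev n d q (p' i) (w i) \<otimes>\<^bsub>AA n d q\<^esub> sA n d q (inverse (b i))
                   \<otimes>\<^bsub>AA n d q\<^esub> hmono n d q (\<lambda>j. - t i j)))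
         \<and> (\<forall>\<phi>. (kalg_hom (AA r d qt) (sA r d qt) (AA n d q) (sA n d q) \<phi> \<and>
             (\<forall>i\<in>{1..r}.
                \<phi> (hA r d qt i) = sA n d q (\<gamma> i) \<otimes>\<^bsub>AA n d q\<^esub> hpow n d q (w i) (m i) \<and>
                \<phi> (xA r d qt i) = lev n d q (p i) (w i) \<otimes>\<^bsub>AA n d q\<^esub> sA n d q (b i)
                   \<otimes>\<^bsub>AA n d q\<^esub> hmono n d q (t i)
                   \<otimes>\<^bsub>AA n d q\<^esub> (if \<tau> i = 0 then xA n d q (w i) else yA n d q (w i)) \<and>
                \<phi> (yA r d qt i) = (if \<tau> i = 0 then yA n d q (w i) else xA n d q (w i))
                   \<otimes>\<^bsub>AA n d q\<^esub> lev n d q (p' i) (w i) \<otimes>\<^bsub>AA n d q\<^esub> sA n d q (inverse (b i))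
                   \<otimes>\<^bsub>AA n d q\<^esub> hmono n d q (\<lambda>j. - t i j)))
             \<longrightarrow> (\<forall>z\<in>carrier (AA r d qt). \<phi> z = \<psi> z))"
proof -
  let ?A = "AA n d q"
  interpret A: weyl_relations ?A "sA n d q" n d q "\<lambda>g. clA n d q (fgen g)"
    by (rule AA_weyl_relations)
  have hpow: "hpow n d q i e = A.hz i e" for i e
    by (simp add: hpow_def A.hz_def hA_def hiA_def)
  have lev: "lev n d q f i = A.laurent f i" for f i
    by (simp add: lev_def A.laurent_def hpow)
  have hmono: "hmono n d q e = A.hzmono e" for e
    by (simp add: hmono_def A.hzmono_def hpow)
  have q0: "q i \<noteq> 0" if "i \<in> {1..n}" for i
    using q that by blast
  have inj: "f = f'" if "i \<in> {1..n}" "A.laurent f i = A.laurent f' i" for i f f'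
    using AA_laurent_inject[OF q0 that] .
  define \<eta> where "\<eta> = A.image_gen w \<tau> m b \<gamma> t p p'"
  have \<eta>: "weyl_relations ?A (sA n d q) r d qt \<eta>"
    unfolding \<eta>_def
    by (rule A.image_weyl_relations[OF q0 inj w \<tau> b\<gamma> c1 c2])
      (use c3 in \<open>simp_all add: lev hpow hA_def\<close>)
  interpret B: weyl_relations ?A "sA n d q" r d qt \<eta> by (rule \<eta>)
  obtain \<psi> where \<psi>: "kalg_hom (AA r d qt) (sA r d qt) ?A (sA n d q) \<psi>"
    "\<And>g. g \<in> Agens r \<Longrightarrow> \<psi> (clA r d qt (fgen g)) = \<eta> g"
    using B.AA_lift by blast
  let ?P = "\<lambda>\<phi>. kalg_hom (AA r d qt) (sA r d qt) ?A (sA n d q) \<phi> \<and>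
    (\<forall>i\<in>{1..r}. \<phi> (hA r d qt i) = \<eta> (Gh i) \<and> \<phi> (xA r d qt i) = \<eta> (Gx i) \<and> \<phi> (yA r d qt i) = \<eta> (Gy i))"
  have P\<psi>: "?P \<psi>"
    using \<psi> by (simp add: hA_def xA_def yA_def)
  have uniq: "\<phi> z = \<psi> z" if \<phi>: "?P \<phi>" and z: "z \<in> carrier (AA r d qt)" for \<phi> z
  proof -
    interpret C: weyl_relations "AA r d qt" "sA r d qt" r d qt "\<lambda>g. clA r d qt (fgen g)"
      by (rule AA_weyl_relations)
    interpret H: ring_hom_ring "AA r d qt" ?A \<phi>
      using \<phi> by (intro ring_hom_ringI2 C.ring_axioms A.ring_axioms) (simp add: kalg_hom_def)
    have gen: "\<phi> (clA r d qt (fgen g)) = \<psi> (clA r d qt (fgen g))" if g: "g \<in> Agens r" for g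
    proof (cases g)
      case (Ghi i)
      with g have i: "i \<in> {1..r}" by simp
      let ?h = "clA r d qt (fgen (Gh i))" and ?hi = "clA r d qt (fgen (Ghi i))"
      have "\<phi> ?h = \<eta> (Gh i)" using \<phi> i by (simp add: hA_def)
      \<comment> \<open>The value on the inverse of h is forced: \<open>\<phi> ?hi\<close> is a left
        inverse of \<open>\<eta> (Gh i)\<close> and \<open>\<eta> (Ghi i)\<close> a right inverse,
        so the two coincide.\<close>
      then have "\<phi> ?hi \<otimes>\<^bsub>?A\<^esub> \<eta> (Gh i) = \<one>\<^bsub>?A\<^esub>"
        using H.hom_mult[of ?hi ?h] C.hi_h[OF i] C.h_closed[OF i] C.hi_closed[OF i] by simp
      then have "\<phi> ?hi = \<eta> (Ghi i)"
        by (rule A.inv_unique[OF _ B.h_hi[OF i] B.h_closed[OF i] H.hom_closed[OF C.hi_closed[OF i]] B.hi_closed[OF i]])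
      then show ?thesis using \<psi>(2)[OF g] Ghi by simp
    qed (use \<phi> P\<psi> g in \<open>simp_all add: hA_def xA_def yA_def\<close>)
    show ?thesis
      by (rule A.pres_hom_unique[OF Arels_closed[of r d qt]])
        (use \<phi> P\<psi> gen z in \<open>simp_all add: AA_def sA_def[abs_def] clA_def[abs_def]\<close>)
  qed
  have images: "\<eta> (Gh i) = sA n d q (\<gamma> i) \<otimes>\<^bsub>?A\<^esub> hpow n d q (w i) (m i)"
    "\<eta> (Gx i) = lev n d q (p i) (w i) \<otimes>\<^bsub>?A\<^esub> sA n d q (b i) \<otimes>\<^bsub>?A\<^esub> hmono n d q (t i)
       \<otimes>\<^bsub>?A\<^esub> (if \<tau> i = 0 then xA n d q (w i) else yA n d q (w i))"
    "\<eta> (Gy i) = (if \<tau> i = 0 then yA n d q (w i) else xA n d q (w i))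
       \<otimes>\<^bsub>?A\<^esub> lev n d q (p' i) (w i) \<otimes>\<^bsub>?A\<^esub> sA n d q (inverse (b i)) \<otimes>\<^bsub>?A\<^esub> hmono n d q (\<lambda>j. - t i j)"
    for i
    by (simp_all add: \<eta>_def A.image_gen_def A.xform_def A.yform_def A.zgen_def A.zgen'_def
        hpow lev hmono xA_def yA_def)
  show ?thesis
    unfolding images[symmetric] using P\<psi> uniq by blast
qed

end
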